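(* Let $\lbrace f_n,D_n\rbrace_{n=-\infty}^{+\infty}$ be a sequence of planar maps and domains, equipped with $\mu_v$-vertical strips $V_i^n\subset D_n$ ($i\in I=\{1,\dots,N\}$, $n\in\mathbb{Z}$), as in the setting described in the context, with $f_n, f_n^{-1}$ of class $C^1$ on their respective domains for every $n\in\mathbb{Z}$. If the nonautonomous conditions A1 and A3 (stated in the context) are satisfied, with the constant $\mu$ of A3 satisfying $0<\mu<1-\mu_h\mu_v$, then the nonautonomous condition A2 (stated in the context) is satisfied.
   Context: **Curves and strips.** Let $D\subset\mathbb{R}^2$ be closed and bounded, $D_x=\{x\in\mathbb{R}: \exists y,\ (x,y)\in D\}$, $D_y=\{y\in\mathbb{R}:\exists x,\ (x,y)\in D\}$, and let $I_x\subset D_x$, $I_y\subset D_y$ be closed intervals. For $0\le\mu_h<\infty$, a $\mu_h$-horizontal curve is the graph $\{(x,h(x)):x\in I_x\}\subset D$ of a function $h:I_x\to\mathbb{R}$ with $|h(x_1)-h(x_2)|\le\mu_h|x_1-x_2|$ for all $x_1,x_2\in I_x$. For $0\le\mu_v<\infty$, a $\mu_v$-vertical curve is a set $\{(v(y),y):y\in I_y\}\subset D$ with $v:I_y\to\mathbb{R}$ and $|v(y_1)-v(y_2)|\le\mu_v|y_1-y_2|$ for all $y_1,y_2\in I_y$. Given two nonintersecting $\mu_v$-vertical curves $v_1(y)<v_2(y)$, $y\in I_y$, a $\mu_v$-vertical strip is $V=\{(x,y): x\in[v_1(y),v_2(y)],\ y\in I_y\}$; given two nonintersecting $\mu_h$-horizontal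 curves $h_1(x)<h_2(x)$, $x\in I_x$, a $\mu_h$-horizontal strip is $H=\{(x,y): y\in[h_1(x),h_2(x)],\ x\in I_x\}$. Widths: $d(H)=\max_{x\in I_x}|h_2(x)-h_1(x)|$, $d(V)=\max_{y\in I_y}|v_2(y)-v_1(y)|$. Boundaries: $\partial_vH=\{(x,y)\in H: x\in\partial I_x\}$ and $\partial_hH=\partial H\setminus\partial_vH$; analogously for a vertical strip $\partial_hV=\{(x,y)\in V: y\in\partial I_y\}$ and $\partial_vV=\partial V\setminus\partial_hV$. $H$ is a $\mu_h$-horizontal strip contained in a $\mu_v$-vertical strip $V$ if the two $\mu_h$-horizontal curves defining the horizontal boundaries of $H$ (denoted $\partial_hH$) are contained in $V$, with the remaining boundary components of $H$ (denoted $\partial_vH$) contained in $\partial_vV$. A $\mu_v$-vertical strip $\widetilde V$ intersects a $\mu_v$-vertical strip $V$ fully if $\widetilde V\subset V$ and $\partial_h\widetilde V\subset\partial_hV$. **Setting.** For each $n\in\mathbb{Z}$, $D_n\subset\mathbb{R}^2$ is a closed bounded domain, $f_n$ is a map defined on $D_n$ with values in $\mathbb{R}^2$, and $f_n(D_n)\cap D_{n+1}\neq\emptyset$. Constants $\mu_h,\mu_v\ge0$ are fixed, $I=\{1,\dots,N\}$, and on each $D_n$ there are pairwise disjoint $\mu_v$-vertical strips $V_1^n,\dots,V_N^n$ such that $f_n$ is one-to-one on $\bigcup_iV_i^n$. Put $H_i^{n+1}=f_n(V_i^n)$, $$H_{ij}^{n+1}=f_n(V_i^n)\cap V_j^{n+1}=H_i^{n+1}\cap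 V_j^{n+1},\qquad V_{ji}^n=f_n^{-1}(V_j^{n+1})\cap V_i^n,$$ where $f_n^{-1}$ is defined on $\bigcup_iH_i^{n+1}$. The transition matrices are $A_{ij}^n=1$ if $H_{ij}^{n+1}\ne\emptyset$ and $A_{ij}^n=0$ otherwise. **A1.** For all $n\in\mathbb{Z}$ and $i,j\in I$ with $A_{ij}^n=1$, $H_{ij}^{n+1}$ is a $\mu_h$-horizontal strip contained in $V_j^{n+1}$, with $0\le\mu_v\mu_h<1$. Moreover $f_n$ maps $V_{ji}^n$ homeomorphically onto $H_{ij}^{n+1}$ with $f_n^{-1}(\partial_hH_{ij}^{n+1})\subset\partial_hV_i^n$. **A2.** (For all $n\in\mathbb{Z}$.) Let $V^{n+1}$ be a $\mu_v$-vertical strip which intersects $V_j^{n+1}$ fully. Then $\widetilde V_i^n:=f_n^{-1}(V^{n+1})\cap V_i^n$ is a $\mu_v$-vertical strip intersecting $V_i^n$ fully for all $i\in I$ such that $A_{ij}^n=1$. Moreover $d(\widetilde V_i^n)\le\nu_v\,d(V^{n+1})$ for some $0<\nu_v<1$. Similarly, let $H^n$ be a $\mu_h$-horizontal strip contained in $V_j^n$ such that also $H^n\subset H_{ij}^n$ for some $i,j\in I$ with $A_{ij}^{n-1}=1$. Then $\widetilde H_k^{n+1}:=f_n(H^n)\cap V_k^{n+1}$ is a $\mu_h$-horizontal strip contained in $V_k^{n+1}$ for all $k\in I$ such that $A_{jk}^n=1$. Moreover $d(\widetilde H_k^{n+1})\le\nu_h\,d(H^n)$ for some $0<\nu_h<1$.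 **Sector bundles.** Let $\mathcal{V}^n=\bigcup_{i,j\in I}V_{ji}^n$ and $\mathcal{H}^{n+1}=\bigcup_{i,j\in I}H_{ij}^{n+1}$, so $f_n(\mathcal{V}^n)=\mathcal{H}^{n+1}$. For $\mathcal{K}$ equal to $\mathcal{V}^n$ or $\mathcal{H}^{n+1}$, with $(\xi_z,\eta_z)$ a tangent vector based at $z$, $$S^u_{\mathcal{K}}=\{(\xi_z,\eta_z)\in\mathbb{R}^2: |\eta_z|\le\mu_h|\xi_z|,\ z\in\mathcal{K}\},\qquad S^s_{\mathcal{K}}=\{(\xi_z,\eta_z)\in\mathbb{R}^2: |\xi_z|\le\mu_v|\eta_z|,\ z\in\mathcal{K}\}.$$ **A3.** There is a constant $\mu>0$ such that for all $n\in\mathbb{Z}$: $Df_n(S^u_{\mathcal{V}^n})\subset S^u_{\mathcal{H}^{n+1}}$ and $Df_n^{-1}(S^s_{\mathcal{H}^{n+1}})\subset S^s_{\mathcal{V}^n}$. Moreover, if $z_0\in\mathcal{V}^n$, $(\xi_{z_0},\eta_{z_0})\in S^u_{\mathcal{V}^n}$ and $(\xi_{f_n(z_0)},\eta_{f_n(z_0)}):=Df_n(z_0)\cdot(\xi_{z_0},\eta_{z_0})\in S^u_{\mathcal{H}^{n+1}}$, then $|\xi_{f_n(z_0)}|\ge\frac1\mu|\xi_{z_0}|$; and if $z_0\in\mathcal{H}^{n+1}$, $(\xi_{z_0},\eta_{z_0})\in S^s_{\mathcal{H}^{n+1}}$ and $(\xi_{f_n^{-1}(z_0)},\eta_{f_n^{-1}(z_0)}):=Df_n^{-1}(z_0)\cdot(\xi_{z_0},\eta_{z_0})\in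 S^s_{\mathcal{V}^n}$, then $|\eta_{f_n^{-1}(z_0)}|\ge\frac1\mu|\eta_{z_0}|$. *)

theory Defs
  imports "HOL-Analysis.Analysis"
begin

type_synonym plane = "real \<times> real"

text \<open>
  A strip is given by its interval \<open>{lo..hi}\<close> and its two bounding curves; whether it is
  read as a vertical strip (curves \<open>x = v y\<close>) or as a horizontal strip (curves \<open>y = h x\<close>)
  is decided by the functions below. The values of the curves outside the interval play no role.
\<close>

datatype strip =
  Strip (lo: real) (hi: real) (curve1: "real \<Rightarrow> real") (curve2: "real \<Rightarrow> real")

definition horizontal_graph :: "real \<Rightarrow> real \<Rightarrow> (real \<Rightarrow> real) \<Rightarrow> plane set" where
  "horizontal_graph a b h = {(x, h x) | x. x \<in> {a..b}}"

definition vertical_graph :: "real \<Rightarrow> real \<Rightarrow> (real \<Rightarrow> real) \<Rightarrow> plane set" where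
  "vertical_graph a b v = {(v y, y) | y. y \<in> {a..b}}"

text \<open>
  Intervals are nondegenerate. The inclusion of the interval in the projection of \<open>D\<close> to the
  relevant axis is a consequence of the graph lying in \<open>D\<close>.
\<close>

definition horizontal_curve ::
    "plane set \<Rightarrow> real \<Rightarrow> real \<Rightarrow> real \<Rightarrow> (real \<Rightarrow> real) \<Rightarrow> bool" where
  "horizontal_curve D \<mu>h a b h \<longleftrightarrow>
     a < b \<and> horizontal_graph a b h \<subseteq> D \<and>
     (\<forall>x1\<in>{a..b}. \<forall>x2\<in>{a..b}. \<bar>h x1 - h x2\<bar> \<le> \<mu>h * \<bar>x1 - x2\<bar>)"

definition vertical_curve ::
    "plane set \<Rightarrow> real \<Rightarrow> real \<Rightarrow> real \<Rightarrow> (real \<Rightarrow> real) \<Rightarrow> bool" where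
  "vertical_curve D \<mu>v a b v \<longleftrightarrow>
     a < b \<and> vertical_graph a b v \<subseteq> D \<and>
     (\<forall>y1\<in>{a..b}. \<forall>y2\<in>{a..b}. \<bar>v y1 - v y2\<bar> \<le> \<mu>v * \<bar>y1 - y2\<bar>)"

definition horizontal_strip :: "plane set \<Rightarrow> real \<Rightarrow> strip \<Rightarrow> bool" where
  "horizontal_strip D \<mu>h H \<longleftrightarrow>
     horizontal_curve D \<mu>h (lo H) (hi H) (curve1 H) \<and>
     horizontal_curve D \<mu>h (lo H) (hi H) (curve2 H) \<and>
     (\<forall>x\<in>{lo H..hi H}. curve1 H x < curve2 H x)"

definition vertical_strip :: "plane set \<Rightarrow> real \<Rightarrow> strip \<Rightarrow> bool" where
  "vertical_strip D \<mu>v V \<longleftrightarrow>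
     vertical_curve D \<mu>v (lo V) (hi V) (curve1 V) \<and>
     vertical_curve D \<mu>v (lo V) (hi V) (curve2 V) \<and>
     (\<forall>y\<in>{lo V..hi V}. curve1 V y < curve2 V y)"

definition hset :: "strip \<Rightarrow> plane set" where
  "hset H = {(x, y). x \<in> {lo H..hi H} \<and> y \<in> {curve1 H x..curve2 H x}}"

definition vset :: "strip \<Rightarrow> plane set" where
  "vset V = {(x, y). y \<in> {lo V..hi V} \<and> x \<in> {curve1 V y..curve2 V y}}"

text \<open>For strips the supremum is a maximum, because the curves are Lipschitz.\<close>

definition width :: "strip \<Rightarrow> real" where
  "width S = (SUP t\<in>{lo S..hi S}. \<bar>curve2 S t - curve1 S t\<bar>)"

text \<open>
  Boundary pieces of a horizontal strip (\<open>hstrip_\<close>) and of a vertical strip (\<open>vstrip_\<close>).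
  The corners belong to the vertical boundary of a horizontal strip, but to the horizontal
  boundary of a vertical strip.
\<close>

definition hstrip_vbd :: "strip \<Rightarrow> plane set" where
  "hstrip_vbd H = {(x, y) \<in> hset H. x \<in> frontier {lo H..hi H}}"

definition hstrip_hbd :: "strip \<Rightarrow> plane set" where
  "hstrip_hbd H = frontier (hset H) - hstrip_vbd H"

definition vstrip_hbd :: "strip \<Rightarrow> plane set" where
  "vstrip_hbd V = {(x, y) \<in> vset V. y \<in> frontier {lo V..hi V}}"

definition vstrip_vbd :: "strip \<Rightarrow> plane set" where
  "vstrip_vbd V = frontier (vset V) - vstrip_hbd V"

definition hstrip_contained_in :: "strip \<Rightarrow> strip \<Rightarrow> bool" where
  "hstrip_contained_in H V \<longleftrightarrow>
     horizontal_graph (lo H) (hi H) (curve1 H) \<subseteq> vset V \<and>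
     horizontal_graph (lo H) (hi H) (curve2 H) \<subseteq> vset V \<and>
     hstrip_vbd H \<subseteq> vstrip_vbd V"

definition intersects_fully :: "strip \<Rightarrow> strip \<Rightarrow> bool" where
  "intersects_fully W V \<longleftrightarrow> vset W \<subseteq> vset V \<and> vstrip_hbd W \<subseteq> vstrip_hbd V"

definition vstrips :: "(int \<Rightarrow> nat \<Rightarrow> strip) \<Rightarrow> nat \<Rightarrow> int \<Rightarrow> plane set" where
  "vstrips V N n = (\<Union>i\<in>{1..N}. vset (V n i))"

text \<open>The map \<open>f\<^sub>n\<inverse>\<close>, meaningful on \<open>f n ` vstrips V N n\<close>.\<close>

definition finv ::
    "(int \<Rightarrow> plane \<Rightarrow> plane) \<Rightarrow> (int \<Rightarrow> nat \<Rightarrow> strip) \<Rightarrow> nat \<Rightarrow> int \<Rightarrow> plane \<Rightarrow> plane" where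
  "finv f V N n = inv_into (vstrips V N n) (f n)"

definition setting ::
    "(int \<Rightarrow> plane \<Rightarrow> plane) \<Rightarrow> (int \<Rightarrow> plane set) \<Rightarrow> (int \<Rightarrow> nat \<Rightarrow> strip) \<Rightarrow> nat
      \<Rightarrow> real \<Rightarrow> real \<Rightarrow> bool" where
  "setting f D V N \<mu>h \<mu>v \<longleftrightarrow>
     1 \<le> N \<and> 0 \<le> \<mu>h \<and> 0 \<le> \<mu>v \<and>
     (\<forall>n. closed (D n) \<and> bounded (D n) \<and> f n ` D n \<inter> D (n + 1) \<noteq> {} \<and>
        (\<forall>i\<in>{1..N}. vertical_strip (D n) \<mu>v (V n i) \<and> vset (V n i) \<subseteq> D n) \<and>
        (\<forall>i\<in>{1..N}. \<forall>j\<in>{1..N}. i \<noteq> j \<longrightarrow> vset (V n i) \<inter> vset (V n j) = {}) \<and>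
        inj_on (f n) (vstrips V N n))"

text \<open>
  \<open>Hij f V n i j\<close> is the set \<open>H\<^sub>i\<^sub>j\<close> with time index \<open>n\<close> (a subset of \<open>D n\<close>, image under
  \<open>f (n - 1)\<close>), and \<open>Vji f V n j i\<close> is the set \<open>V\<^sub>j\<^sub>i\<close> with time index \<open>n\<close>.
\<close>

definition Hij ::
    "(int \<Rightarrow> plane \<Rightarrow> plane) \<Rightarrow> (int \<Rightarrow> nat \<Rightarrow> strip) \<Rightarrow> int \<Rightarrow> nat \<Rightarrow> nat \<Rightarrow> plane set" where
  "Hij f V n i j = f (n - 1) ` vset (V (n - 1) i) \<inter> vset (V n j)"

definition Vji ::
    "(int \<Rightarrow> plane \<Rightarrow> plane) \<Rightarrow> (int \<Rightarrow> nat \<Rightarrow> strip) \<Rightarrow> int \<Rightarrow> nat \<Rightarrow> nat \<Rightarrow> plane set" where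
  "Vji f V n j i = f n -` vset (V (n + 1) j) \<inter> vset (V n i)"

definition transition ::
    "(int \<Rightarrow> plane \<Rightarrow> plane) \<Rightarrow> (int \<Rightarrow> nat \<Rightarrow> strip) \<Rightarrow> int \<Rightarrow> nat \<Rightarrow> nat \<Rightarrow> nat" where
  "transition f V n i j = (if Hij f V (n + 1) i j \<noteq> {} then 1 else 0)"

definition A1 ::
    "(int \<Rightarrow> plane \<Rightarrow> plane) \<Rightarrow> (int \<Rightarrow> plane set) \<Rightarrow> (int \<Rightarrow> nat \<Rightarrow> strip) \<Rightarrow> nat
      \<Rightarrow> real \<Rightarrow> real \<Rightarrow> bool" where
  "A1 f D V N \<mu>h \<mu>v \<longleftrightarrow>
     0 \<le> \<mu>v * \<mu>h \<and> \<mu>v * \<mu>h < 1 \<and>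
     (\<forall>n. \<forall>i\<in>{1..N}. \<forall>j\<in>{1..N}. transition f V n i j = 1 \<longrightarrow>
        (\<exists>H. hset H = Hij f V (n + 1) i j \<and>
             horizontal_strip (D (n + 1)) \<mu>h H \<and>
             hstrip_contained_in H (V (n + 1) j) \<and>
             homeomorphism (Vji f V n j i) (Hij f V (n + 1) i j) (f n) (finv f V N n) \<and>
             finv f V N n ` hstrip_hbd H \<subseteq> vstrip_hbd (V n i)))"

definition A2 ::
    "(int \<Rightarrow> plane \<Rightarrow> plane) \<Rightarrow> (int \<Rightarrow> plane set) \<Rightarrow> (int \<Rightarrow> nat \<Rightarrow> strip) \<Rightarrow> nat
      \<Rightarrow> real \<Rightarrow> real \<Rightarrow> bool" where
  "A2 f D V N \<mu>h \<mu>v \<longleftrightarrow>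
     (\<exists>\<nu>v. 0 < \<nu>v \<and> \<nu>v < 1 \<and>
       (\<forall>n. \<forall>j\<in>{1..N}. \<forall>W.
          vertical_strip (D (n + 1)) \<mu>v W \<and> intersects_fully W (V (n + 1) j) \<longrightarrow>
          (\<forall>i\<in>{1..N}. transition f V n i j = 1 \<longrightarrow>
             (\<exists>W'. vset W' = f n -` vset W \<inter> vset (V n i) \<and>
                   vertical_strip (D n) \<mu>v W' \<and>
                   intersects_fully W' (V n i) \<and>
                   width W' \<le> \<nu>v * width W)))) \<and>
     (\<exists>\<nu>h. 0 < \<nu>h \<and> \<nu>h < 1 \<and>
       (\<forall>n. \<forall>i\<in>{1..N}. \<forall>j\<in>{1..N}. \<forall>H.
          transition f V (n - 1) i j = 1 \<and>
          horizontal_strip (D n) \<mu>h H \<and> hstrip_contained_in H (V n j) \<and>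
          hset H \<subseteq> Hij f V n i j \<longrightarrow>
          (\<forall>k\<in>{1..N}. transition f V n j k = 1 \<longrightarrow>
             (\<exists>H'. hset H' = f n ` hset H \<inter> vset (V (n + 1) k) \<and>
                   horizontal_strip (D (n + 1)) \<mu>h H' \<and>
                   hstrip_contained_in H' (V (n + 1) k) \<and>
                   width H' \<le> \<nu>h * width H))))"

text \<open>
  \<open>f\<close> is of class \<open>C\<^sup>1\<close> on \<open>S\<close> with derivative \<open>Df\<close>. The set \<open>S\<close> is typically closed, so
  derivatives are taken within \<open>S\<close>.
\<close>

definition C1_on :: "plane set \<Rightarrow> (plane \<Rightarrow> plane) \<Rightarrow> (plane \<Rightarrow> plane \<Rightarrow>\<^sub>L plane) \<Rightarrow> bool" where
  "C1_on S f Df \<longleftrightarrow>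
     (\<forall>z\<in>S. (f has_derivative blinfun_apply (Df z)) (at z within S)) \<and> continuous_on S Df"

definition calV ::
    "(int \<Rightarrow> plane \<Rightarrow> plane) \<Rightarrow> (int \<Rightarrow> nat \<Rightarrow> strip) \<Rightarrow> nat \<Rightarrow> int \<Rightarrow> plane set" where
  "calV f V N n = (\<Union>i\<in>{1..N}. \<Union>j\<in>{1..N}. Vji f V n j i)"

definition calH ::
    "(int \<Rightarrow> plane \<Rightarrow> plane) \<Rightarrow> (int \<Rightarrow> nat \<Rightarrow> strip) \<Rightarrow> nat \<Rightarrow> int \<Rightarrow> plane set" where
  "calH f V N n = (\<Union>i\<in>{1..N}. \<Union>j\<in>{1..N}. Hij f V n i j)"

text \<open>Elements of the sector bundles are pairs of a base point and a tangent vector.\<close>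

definition unstable_sector :: "real \<Rightarrow> plane set \<Rightarrow> (plane \<times> plane) set" where
  "unstable_sector \<mu>h K = {(z, \<xi>, \<eta>). z \<in> K \<and> \<bar>\<eta>\<bar> \<le> \<mu>h * \<bar>\<xi>\<bar>}"

definition stable_sector :: "real \<Rightarrow> plane set \<Rightarrow> (plane \<times> plane) set" where
  "stable_sector \<mu>v K = {(z, \<xi>, \<eta>). z \<in> K \<and> \<bar>\<xi>\<bar> \<le> \<mu>v * \<bar>\<eta>\<bar>}"

definition tangent_map ::
    "(plane \<Rightarrow> plane) \<Rightarrow> (plane \<Rightarrow> plane \<Rightarrow>\<^sub>L plane) \<Rightarrow> plane \<times> plane \<Rightarrow> plane \<times> plane" where
  "tangent_map f Df = (\<lambda>(z, w). (f z, blinfun_apply (Df z) w))"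

text \<open>\<open>Df n\<close> and \<open>Dfinv n\<close> stand for the derivatives of \<open>f n\<close> and of \<open>finv f V N n\<close>.\<close>

definition A3 ::
    "(int \<Rightarrow> plane \<Rightarrow> plane) \<Rightarrow> (int \<Rightarrow> plane \<Rightarrow> plane \<Rightarrow>\<^sub>L plane)
      \<Rightarrow> (int \<Rightarrow> plane \<Rightarrow> plane \<Rightarrow>\<^sub>L plane) \<Rightarrow> (int \<Rightarrow> nat \<Rightarrow> strip) \<Rightarrow> nat
      \<Rightarrow> real \<Rightarrow> real \<Rightarrow> real \<Rightarrow> bool" where
  "A3 f Df Dfinv V N \<mu>h \<mu>v \<mu> \<longleftrightarrow>
     0 < \<mu> \<and>
     (\<forall>n.
        tangent_map (f n) (Df n) ` unstable_sector \<mu>h (calV f V N n)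
          \<subseteq> unstable_sector \<mu>h (calH f V N (n + 1)) \<and>
        tangent_map (finv f V N n) (Dfinv n) ` stable_sector \<mu>v (calH f V N (n + 1))
          \<subseteq> stable_sector \<mu>v (calV f V N n) \<and>
        (\<forall>z w. (z, w) \<in> unstable_sector \<mu>h (calV f V N n) \<and>
           tangent_map (f n) (Df n) (z, w) \<in> unstable_sector \<mu>h (calH f V N (n + 1)) \<longrightarrow>
           \<bar>fst (blinfun_apply (Df n z) w)\<bar> \<ge> 1 / \<mu> * \<bar>fst w\<bar>) \<and>
        (\<forall>z w. (z, w) \<in> stable_sector \<mu>v (calH f V N (n + 1)) \<and>
           tangent_map (finv f V N n) (Dfinv n) (z, w) \<in> stable_sector \<mu>v (calV f V N n) \<longrightarrow>
           \<bar>snd (blinfun_apply (Dfinv n z) w)\<bar> \<ge> 1 / \<mu> * \<bar>snd w\<bar>))"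

end

theory Submission
  imports Defs
begin

text \<open>
  Both halves of A2 are instances of one graph transform. By A1 a transition from \<open>V\<^sub>i\<close> to \<open>V\<^sub>j\<close>
  is a homeomorphism between \<open>V\<^sub>j\<^sub>i\<close> and a horizontal strip \<open>H\<^sub>i\<^sub>j\<close> that reaches from the left to
  the right boundary of \<open>V\<^sub>j\<close>. By A3 its inverse maps steep vectors to steep vectors and expands
  their height by \<open>1 / \<mu>\<close>, while the map itself does the same to flat vectors and their horizontal
  component. Lipschitz curves have chords in these cones, so a steep curve in \<open>H\<^sub>i\<^sub>j\<close> has a steep
  curve as preimage, on which height is strictly monotone (\<open>cone_expanding_curve\<close>).

  Let \<open>W\<close> be a vertical strip that intersects \<open>V\<^sub>j\<close> fully. Foliate it by convex combinations
  of its boundary curves. Because \<open>\<mu>h * \<mu>v < 1\<close>, each leaf crosses \<open>H\<^sub>i\<^sub>j\<close> exactly once from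
  the lower to the upper boundary (\<open>curve_crosses_strip\<close>), and these boundaries come from the
  bottom and top of \<open>V\<^sub>i\<close>. So the preimage of each leaf is a steep graph over the whole height of
  \<open>V\<^sub>i\<close>, and the preimages of all leaves fill a strip that intersects \<open>V\<^sub>i\<close> fully
  (\<open>strip_transform\<close>, \<open>strip_pullback\<close>).

  Taking \<open>W = V\<^sub>k\<close> shows that the domain \<open>V\<^sub>k\<^sub>j\<close> of each branch is itself a full vertical strip of
  \<open>V\<^sub>j\<close> whose boundary curves are mapped into those of \<open>V\<^sub>k\<close>. A horizontal strip in \<open>V\<^sub>j\<close>
  crosses this domain from left to right, and the same argument with the coordinates exchanged
  shows that its image is a horizontal strip of \<open>V\<^sub>k\<close> (\<open>strip_pushforward\<close>).

  For the widths, a segment across the new strip is carried to a curve across the old one,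
  which is longer by a factor of at least \<open>1 / \<mu>\<close>. Since this curve and the boundary curves of the old
  strip are Lipschitz, its extent is at most the old width divided by \<open>1 - \<mu>h * \<mu>v\<close>. Both widths
  therefore contract by \<open>\<mu> / (1 - \<mu>h * \<mu>v)\<close>, which is less than \<open>1\<close> by hypothesis.
\<close>

section \<open>Lipschitz curves under cone-preserving maps\<close>

text \<open>
  The curve is only Lipschitz, so its image under \<open>\<phi>\<close> may have no tangent. Its chords,
  however, lie in the cone on which the derivative of \<open>\<phi>\<close> is controlled: differentiating
  \<open>\<phi>\<close> at a point and applying the derivative to the chords through that point gives the estimate
  near each point up to an arbitrarily small error, and bisection adds up these local estimates.
  A linear functional \<open>\<gamma>\<close> is used because expansion and the slope bound are the same kind of
  inequality for different functionals.
\<close>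

lemma cone_mean_value:
  fixes \<phi> :: "plane \<Rightarrow> plane" and \<gamma> :: "plane \<Rightarrow> real"
  assumes deriv: "\<And>z. z \<in> K \<Longrightarrow> (\<phi> has_derivative L z) (at z within K)"
    and lip: "\<alpha>-lipschitz_on {p..q} w"
    and inK: "\<And>s. s \<in> {p..q} \<Longrightarrow> (w s, s) \<in> K"
    and bl: "bounded_linear \<gamma>"
    and cone: "\<And>s \<xi> \<eta>. s \<in> {p..q} \<Longrightarrow> 0 \<le> \<eta> \<Longrightarrow> \<bar>\<xi>\<bar> \<le> \<alpha> * \<eta> \<Longrightarrow> k * \<eta> \<le> \<gamma> (L (w s, s) (\<xi>, \<eta>))"
    and pq: "p \<le> q"
  shows "k * (q - p) \<le> \<gamma> (\<phi> (w q, q)) - \<gamma> (\<phi> (w p, p))"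
proof -
  define F where "F s = \<gamma> (\<phi> (w s, s))" for s
  have lam: "0 \<le> \<alpha>" using lip by (simp add: lipschitz_on_def)
  obtain C where C: "0 < C" "\<And>v. \<bar>\<gamma> v\<bar> \<le> norm v * C"
    using bounded_linear.pos_bounded[OF bl] by auto
  have wlip: "\<bar>w s - w s'\<bar> \<le> \<alpha> * \<bar>s - s'\<bar>" if "s \<in> {p..q}" "s' \<in> {p..q}" for s s'
    using lipschitz_onD[OF lip that] by (simp add: dist_real_def)
  have approx: "\<exists>\<delta>>0. \<forall>s'\<in>{p..q}. \<bar>s' - s\<bar> < \<delta> \<longrightarrow>
      \<bar>F s' - F s - \<gamma> (L (w s, s) (w s' - w s, s' - s))\<bar> \<le> e * \<bar>s' - s\<bar>"
    if s: "s \<in> {p..q}" and e: "0 < e" for s e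
  proof -
    define e' where "e' = e / (C * (\<alpha> + 1))"
    have e': "0 < e'" using e C(1) lam by (simp add: e'_def)
    obtain \<delta> where \<delta>: "0 < \<delta>" "\<And>z. z \<in> K \<Longrightarrow> norm (z - (w s, s)) < \<delta> \<Longrightarrow>
        norm (\<phi> z - \<phi> (w s, s) - L (w s, s) (z - (w s, s))) \<le> e' * norm (z - (w s, s))"
      using deriv[OF inK[OF s]] e' unfolding has_derivative_within_alt by meson
    have "\<bar>F s' - F s - \<gamma> (L (w s, s) (w s' - w s, s' - s))\<bar> \<le> e * \<bar>s' - s\<bar>"
      if s': "s' \<in> {p..q}" "\<bar>s' - s\<bar> < \<delta> / (\<alpha> + 1)" for s'
    proof -
      have n: "norm ((w s', s') - (w s, s)) \<le> (\<alpha> + 1) * \<bar>s' - s\<bar>"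
      proof -
        have "norm ((w s', s') - (w s, s)) \<le> \<bar>w s' - w s\<bar> + \<bar>s' - s\<bar>"
          using norm_Pair_le[of "w s' - w s" "s' - s"] by simp
        thus ?thesis using wlip[OF s'(1) s] by (simp add: algebra_simps)
      qed
      have "norm ((w s', s') - (w s, s)) < \<delta>"
        using n s'(2) lam by (smt (verit) mult.commute pos_less_divide_eq)
      from \<delta>(2)[OF inK[OF s'(1)] this]
      have "norm (\<phi> (w s', s') - \<phi> (w s, s) - L (w s, s) (w s' - w s, s' - s)) \<le> e' * ((\<alpha> + 1) * \<bar>s' - s\<bar>)"
        using mult_left_mono[OF n, of e'] e' by (auto intro: order_trans)
      hence "norm (\<phi> (w s', s') - \<phi> (w s, s) - L (w s, s) (w s' - w s, s' - s)) * C
          \<le> e' * ((\<alpha> + 1) * \<bar>s' - s\<bar>) * C"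
        using C(1) by (simp add: mult_right_mono)
      also have "\<dots> = e * \<bar>s' - s\<bar>" using C(1) lam by (simp add: e'_def)
      finally have "\<bar>\<gamma> (\<phi> (w s', s') - \<phi> (w s, s) - L (w s, s) (w s' - w s, s' - s))\<bar> \<le> e * \<bar>s' - s\<bar>"
        using C(2) order_trans by blast
      thus ?thesis by (simp add: F_def linear_diff[OF bounded_linear.linear[OF bl]])
    qed
    thus ?thesis using \<delta>(1) lam by (intro exI[of _ "\<delta> / (\<alpha> + 1)"]) auto
  qed
  have "(k - e) * (q - p) \<le> F q - F p" if e: "0 < e" for e
  proof -
    \<comment> \<open>The bounds restrict the interval to {p..q}, since bisection asks for all small
      intervals around a point.\<close>
    have "p \<le> p \<and> q \<le> q \<longrightarrow> (k - e) * (q - p) \<le> F q - F p"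
    proof (rule Bolzano[OF pq, where P = "\<lambda>a b. p \<le> a \<and> b \<le> q \<longrightarrow> (k - e) * (b - a) \<le> F b - F a"])
      fix a b c
      assume "p \<le> a \<and> b \<le> q \<longrightarrow> (k - e) * (b - a) \<le> F b - F a"
        "p \<le> b \<and> c \<le> q \<longrightarrow> (k - e) * (c - b) \<le> F c - F b" "a \<le> b" "b \<le> c"
      thus "p \<le> a \<and> c \<le> q \<longrightarrow> (k - e) * (c - a) \<le> F c - F a"
        by (auto simp: algebra_simps)
    next
      fix x assume x: "p \<le> x" "x \<le> q"
      then obtain \<delta> where \<delta>: "0 < \<delta>" "\<And>s'. s' \<in> {p..q} \<Longrightarrow> \<bar>s' - x\<bar> < \<delta> \<Longrightarrow>
          \<bar>F s' - F x - \<gamma> (L (w x, x) (w s' - w x, s' - x))\<bar> \<le> e * \<bar>s' - x\<bar>"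
        using approx[of x e] e by auto
      have x: "x \<in> {p..q}" using x by simp
      have "(k - e) * (b - a) \<le> F b - F a"
        if ab: "a \<le> x" "x \<le> b" "b - a < \<delta>" "p \<le> a" "b \<le> q" for a b
      proof -
        have "k * (b - x) \<le> \<gamma> (L (w x, x) (w b - w x, b - x))"
          using cone[OF x, of "b - x" "w b - w x"] wlip[of b x] ab x by auto
        moreover have "\<bar>F b - F x - \<gamma> (L (w x, x) (w b - w x, b - x))\<bar> \<le> e * (b - x)"
          using \<delta>(2)[of b] ab x by auto
        moreover have "k * (x - a) \<le> \<gamma> (L (w x, x) (w x - w a, x - a))"
          using cone[OF x, of "x - a" "w x - w a"] wlip[of x a] ab x by auto
        moreover have "\<gamma> (L (w x, x) (w x - w a, x - a)) = - \<gamma> (L (w x, x) (w a - w x, a - x))"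
        proof -
          have "linear (\<lambda>v. \<gamma> (L (w x, x) v))"
            using has_derivative_linear[OF deriv[OF inK[OF x]]] bounded_linear.linear[OF bl]
            by (rule linear_compose[unfolded o_def])
          from linear_neg[OF this, of "(w a - w x, a - x)"] show ?thesis by simp
        qed
        moreover have "\<bar>F a - F x - \<gamma> (L (w x, x) (w a - w x, a - x))\<bar> \<le> e * (x - a)"
          using \<delta>(2)[of a] ab x by auto
        ultimately show ?thesis by (simp add: algebra_simps abs_le_iff)
      qed
      thus "\<exists>d>0. \<forall>a b. a \<le> x \<and> x \<le> b \<and> b - a < d \<longrightarrow>
          p \<le> a \<and> b \<le> q \<longrightarrow> (k - e) * (b - a) \<le> F b - F a" using \<delta>(1) by blast
    qed
    thus ?thesis by simp
  qed
  hence bound: "k * (q - p) - e * (q - p) \<le> F q - F p" if "0 < e" for e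
    using that by (simp add: algebra_simps)
  have "k * (q - p) \<le> F q - F p + \<epsilon>" if "0 < \<epsilon>" for \<epsilon>
  proof -
    have "\<epsilon> / (q - p + 1) * (q - p) \<le> \<epsilon>" using pq that by (simp add: field_simps)
    thus ?thesis using bound[of "\<epsilon> / (q - p + 1)"] pq that by simp
  qed
  thus ?thesis unfolding F_def by (rule field_le_epsilon)
qed

text \<open>
  Invariance of the cone of steep vectors together with expansion of their height by \<open>1 / \<mu>\<close>.
  The invariance of flat vectors is the same condition after exchanging the two coordinates. The
  family \<open>L\<close> is existential, since a derivative within a set can fail to be unique; the
  continuity clause makes the orientation of the image of the vertical direction locally constant.
\<close>

definition cone_expanding :: "real \<Rightarrow> real \<Rightarrow> (plane \<Rightarrow> plane) \<Rightarrow> plane set \<Rightarrow> bool" where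
  "cone_expanding \<alpha> \<mu> \<phi> K \<longleftrightarrow>
     (\<exists>L. (\<forall>z\<in>K. (\<phi> has_derivative L z) (at z within K)) \<and>
          continuous_on K (\<lambda>z. snd (L z (0, 1))) \<and>
          (\<forall>z\<in>K. \<forall>\<xi> \<eta>. \<bar>\<xi>\<bar> \<le> \<alpha> * \<bar>\<eta>\<bar> \<longrightarrow>
             \<bar>fst (L z (\<xi>, \<eta>))\<bar> \<le> \<alpha> * \<bar>snd (L z (\<xi>, \<eta>))\<bar> \<and> \<bar>\<eta>\<bar> \<le> \<mu> * \<bar>snd (L z (\<xi>, \<eta>))\<bar>))"

text \<open>
  On an upward vector of the cone the height of the image cannot vanish, so its sign \<open>\<sigma>\<close> is the
  same for the whole upward half of the cone (which is convex) and along the whole curve (which is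
  connected). After multiplication by \<open>\<sigma>\<close> the absolute values in the cone condition
  disappear and both claims are instances of the previous mean value inequality.
\<close>

lemma cone_expanding_curve:
  assumes exp: "cone_expanding \<alpha> \<mu> \<phi> K" and \<mu>: "0 < \<mu>"
    and lip: "\<alpha>-lipschitz_on {p..q} w"
    and inK: "\<And>s. s \<in> {p..q} \<Longrightarrow> (w s, s) \<in> K"
    and s: "s \<in> {p..q}" "s' \<in> {p..q}"
  shows "\<bar>s - s'\<bar> \<le> \<mu> * \<bar>snd (\<phi> (w s, s)) - snd (\<phi> (w s', s'))\<bar>"
    and "\<bar>fst (\<phi> (w s, s)) - fst (\<phi> (w s', s'))\<bar> \<le> \<alpha> * \<bar>snd (\<phi> (w s, s)) - snd (\<phi> (w s', s'))\<bar>"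
proof -
  obtain L where deriv: "\<And>z. z \<in> K \<Longrightarrow> (\<phi> has_derivative L z) (at z within K)"
    and cont: "continuous_on K (\<lambda>z. snd (L z (0, 1)))"
    and cone: "\<And>z \<xi> \<eta>. z \<in> K \<Longrightarrow> \<bar>\<xi>\<bar> \<le> \<alpha> * \<bar>\<eta>\<bar> \<Longrightarrow>
       \<bar>fst (L z (\<xi>, \<eta>))\<bar> \<le> \<alpha> * \<bar>snd (L z (\<xi>, \<eta>))\<bar> \<and> \<bar>\<eta>\<bar> \<le> \<mu> * \<bar>snd (L z (\<xi>, \<eta>))\<bar>"
    using exp unfolding cone_expanding_def by blast
  have lam: "0 \<le> \<alpha>" using lip by (simp add: lipschitz_on_def)
  define A where "A s = snd (L (w s, s) (0, 1))" for s
  have A0: "A s \<noteq> 0" if "s \<in> {p..q}" for s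
    using cone[OF inK[OF that], of 0 1] lam by (auto simp: A_def)
  have contA: "continuous_on {p..q} A"
    unfolding A_def
    by (rule continuous_on_compose2[OF cont])
       (auto intro!: continuous_intros lipschitz_on_continuous_on[OF lip] inK)
  have "(\<forall>s\<in>{p..q}. 0 < A s) \<or> (\<forall>s\<in>{p..q}. A s < 0)"
  proof (rule ccontr)
    assume "\<not> ?thesis"
    then obtain s s' where s: "s \<in> {p..q}" "s' \<in> {p..q}" "A s \<le> 0" "0 \<le> A s'"
      by (auto simp: not_less)
    have "is_interval (A ` {p..q})"
      using contA by (simp add: connected_continuous_image is_interval_connected_1)
    hence "0 \<in> A ` {p..q}"
      using mem_is_interval_1_I[of "A ` {p..q}" "A s" "A s'" 0] s by blast
    thus False using A0 by fastforce
  qed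
  then obtain \<sigma> :: real where \<sigma>: "\<bar>\<sigma>\<bar> = 1" and \<sigma>A: "\<And>s. s \<in> {p..q} \<Longrightarrow> 0 < \<sigma> * A s"
  proof
    assume "\<forall>s\<in>{p..q}. 0 < A s" thus thesis using that[of 1] by simp
  next
    assume "\<forall>s\<in>{p..q}. A s < 0" thus thesis using that[of "-1"] by simp
  qed
  have sign: "\<bar>snd (L (w s, s) (\<xi>, \<eta>))\<bar> = \<sigma> * snd (L (w s, s) (\<xi>, \<eta>))"
    if s: "s \<in> {p..q}" and \<eta>: "0 \<le> \<eta>" and \<xi>: "\<bar>\<xi>\<bar> \<le> \<alpha> * \<eta>" for s \<xi> \<eta>
  proof (rule ccontr)
    let ?B = "snd (L (w s, s) (\<xi>, \<eta>))"
    assume "\<bar>?B\<bar> \<noteq> \<sigma> * ?B"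
    hence B: "\<sigma> * ?B < 0" using \<sigma> by (auto simp: abs_if split: if_splits)
    interpret L: linear "L (w s, s)" using has_derivative_linear[OF deriv[OF inK[OF s]]] .
    \<comment> \<open>Adding t times the vertical unit vector keeps the vector inside the cone and makes
      the height of its image zero.\<close>
    define t where "t = - (\<sigma> * ?B) / (\<sigma> * A s)"
    have t: "0 < t" unfolding t_def by (rule divide_pos_pos) (use B \<sigma>A[OF s] in auto)
    have "snd (L (w s, s) (\<xi>, \<eta> + t)) = snd (L (w s, s) ((\<xi>, \<eta>) + t *\<^sub>R (0, 1)))" by simp
    also have "\<dots> = ?B + t * A s" unfolding L.add L.scale by (simp add: A_def)
    also have "\<dots> = 0" using \<sigma>A[OF s] A0[OF s] \<sigma> by (auto simp: t_def)
    finally have "snd (L (w s, s) (\<xi>, \<eta> + t)) = 0" .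
    moreover have "\<bar>\<xi>\<bar> \<le> \<alpha> * \<bar>\<eta> + t\<bar>" using \<xi> \<eta> t lam by (smt (verit) mult_left_mono)
    ultimately show False using cone[OF inK[OF s], of \<xi> "\<eta> + t"] t \<eta> by simp
  qed
  have sub: "\<alpha>-lipschitz_on {s..s'} w" if "p \<le> s" "s' \<le> q" for s s'
    using lip by (rule lipschitz_on_subset) (use that in auto)
  have ordered: "s' - s \<le> \<mu> * \<bar>snd (\<phi> (w s', s')) - snd (\<phi> (w s, s))\<bar> \<and>
      \<bar>fst (\<phi> (w s', s')) - fst (\<phi> (w s, s))\<bar> \<le> \<alpha> * \<bar>snd (\<phi> (w s', s')) - snd (\<phi> (w s, s))\<bar>"
    if s: "p \<le> s" "s \<le> s'" "s' \<le> q" for s s'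
  proof
    have \<sigma>_le: "\<sigma> * v \<le> \<bar>v\<bar>" for v
      using \<sigma> by (auto simp: abs_if split: if_splits)
    let ?Y = "snd (\<phi> (w s', s')) - snd (\<phi> (w s, s))"
    have bl: "bounded_linear (\<lambda>v. \<mu> * (\<sigma> * snd v))" by (intro bounded_linear_intros)
    have "1 * (s' - s) \<le> \<mu> * (\<sigma> * snd (\<phi> (w s', s'))) - \<mu> * (\<sigma> * snd (\<phi> (w s, s)))"
    proof (rule cone_mean_value[OF deriv sub[OF s(1,3)] inK bl _ s(2)])
      fix r \<xi> \<eta> assume r: "r \<in> {s..s'}" "0 \<le> \<eta>" "\<bar>\<xi>\<bar> \<le> \<alpha> * \<eta>"
      hence r': "r \<in> {p..q}" using s by auto
      show "1 * \<eta> \<le> \<mu> * (\<sigma> * snd (L (w r, r) (\<xi>, \<eta>)))"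
        using cone[OF inK[OF r'], of \<xi> \<eta>] sign[OF r' r(2,3)] r by simp
    qed (use s in auto)
    also have "\<dots> = \<mu> * (\<sigma> * ?Y)" by (simp add: algebra_simps)
    also have "\<dots> \<le> \<mu> * \<bar>?Y\<bar>" using \<mu> \<sigma>_le by (intro mult_left_mono) auto
    finally show "s' - s \<le> \<mu> * \<bar>?Y\<bar>" by simp
    \<comment> \<open>The two signs of \<tau> give the two halves of the slope bound.\<close>
    have "\<tau> * (fst (\<phi> (w s', s')) - fst (\<phi> (w s, s))) \<le> \<alpha> * \<bar>?Y\<bar>"
      if \<tau>: "\<bar>\<tau>\<bar> = 1" for \<tau>
    proof -
      have bl: "bounded_linear (\<lambda>v. \<alpha> * (\<sigma> * snd v) - \<tau> * fst v)" by (intro bounded_linear_intros)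
      have "0 * (s' - s) \<le> (\<alpha> * (\<sigma> * snd (\<phi> (w s', s'))) - \<tau> * fst (\<phi> (w s', s')))
          - (\<alpha> * (\<sigma> * snd (\<phi> (w s, s))) - \<tau> * fst (\<phi> (w s, s)))"
      proof (rule cone_mean_value[OF deriv sub[OF s(1,3)] inK bl _ s(2)])
        fix r \<xi> \<eta> assume r: "r \<in> {s..s'}" "0 \<le> \<eta>" "\<bar>\<xi>\<bar> \<le> \<alpha> * \<eta>"
        hence r': "r \<in> {p..q}" using s by auto
        have "\<tau> * fst (L (w r, r) (\<xi>, \<eta>)) \<le> \<bar>fst (L (w r, r) (\<xi>, \<eta>))\<bar>"
          using \<tau> by (auto simp: abs_if split: if_splits)
        thus "0 * \<eta> \<le> \<alpha> * (\<sigma> * snd (L (w r, r) (\<xi>, \<eta>))) - \<tau> * fst (L (w r, r) (\<xi>, \<eta>))"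
          using cone[OF inK[OF r'], of \<xi> \<eta>] sign[OF r' r(2,3)] r by simp
      qed (use s in auto)
      hence "\<tau> * (fst (\<phi> (w s', s')) - fst (\<phi> (w s, s))) \<le> \<alpha> * (\<sigma> * ?Y)"
        by (simp add: algebra_simps)
      also have "\<dots> \<le> \<alpha> * \<bar>?Y\<bar>" using lam \<sigma>_le by (intro mult_left_mono)
      finally show ?thesis .
    qed
    from this[of 1] this[of "-1"]
    show "\<bar>fst (\<phi> (w s', s')) - fst (\<phi> (w s, s))\<bar> \<le> \<alpha> * \<bar>?Y\<bar>" by (simp add: abs_le_iff)
  qed
  show "\<bar>s - s'\<bar> \<le> \<mu> * \<bar>snd (\<phi> (w s, s)) - snd (\<phi> (w s', s'))\<bar>"
    and "\<bar>fst (\<phi> (w s, s)) - fst (\<phi> (w s', s'))\<bar> \<le> \<alpha> * \<bar>snd (\<phi> (w s, s)) - snd (\<phi> (w s', s'))\<bar>"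
    using ordered[of s s'] ordered[of s' s] s
    by (cases "s \<le> s'"; simp add: abs_minus_commute)+
qed

text \<open>
  Height along the image curve is injective by expansion, hence it runs exactly once through the
  interval between its end values; the slope bound then makes the image a Lipschitz graph.
\<close>

lemma cone_expanding_graph_image:
  assumes exp: "cone_expanding \<alpha> \<mu> \<phi> K" and \<mu>: "0 < \<mu>"
    and lip: "\<alpha>-lipschitz_on {p..q} w" and pq: "p < q"
    and inK: "\<And>s. s \<in> {p..q} \<Longrightarrow> (w s, s) \<in> K"
    and cont: "continuous_on K \<phi>"
    and ends: "snd (\<phi> (w p, p)) \<in> {c, d}" "snd (\<phi> (w q, q)) \<in> {c, d}" and cd: "c < d"
  obtains u where "\<alpha>-lipschitz_on {c..d} u" "\<phi> ` vertical_graph p q w = vertical_graph c d u"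
proof -
  have lam: "0 \<le> \<alpha>" using lip by (simp add: lipschitz_on_def)
  define Y where "Y s = snd (\<phi> (w s, s))" for s
  define X where "X s = fst (\<phi> (w s, s))" for s
  have expand: "\<bar>s - s'\<bar> \<le> \<mu> * \<bar>Y s - Y s'\<bar>"
    and slope: "\<bar>X s - X s'\<bar> \<le> \<alpha> * \<bar>Y s - Y s'\<bar>" if "s \<in> {p..q}" "s' \<in> {p..q}" for s s'
    using cone_expanding_curve[OF exp \<mu> lip inK that] unfolding X_def Y_def by auto
  have inj: "inj_on Y {p..q}"
    by (rule inj_onI) (use expand in fastforce)
  have "continuous_on {p..q} (\<lambda>s. \<phi> (w s, s))"
    by (rule continuous_on_compose2[OF cont])
       (auto intro!: continuous_intros lipschitz_on_continuous_on[OF lip] inK)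
  hence contY: "continuous_on {p..q} Y" unfolding Y_def by (intro continuous_intros)
  have "Y ` closed_segment p q = closed_segment (Y p) (Y q)"
    by (rule continuous_injective_image_segment_1) (use contY inj pq in \<open>auto simp: closed_segment_eq_real_ivl\<close>)
  moreover have "Y p \<noteq> Y q" using inj_onD[OF inj, of p q] pq by auto
  ultimately have img: "Y ` {p..q} = {c..d}"
    using ends cd pq by (auto simp: closed_segment_eq_real_ivl Y_def split: if_splits)
  define T where "T = inv_into {p..q} Y"
  define u where "u = X \<circ> T"
  have T: "T y \<in> {p..q}" "Y (T y) = y" if "y \<in> {c..d}" for y
    using that inv_into_into[of y Y "{p..q}"] f_inv_into_f[of y Y "{p..q}"]
    unfolding T_def img by auto
  have TY: "T (Y s) = s" if "s \<in> {p..q}" for s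
    using that inj by (simp add: T_def)
  show thesis
  proof
    show "\<alpha>-lipschitz_on {c..d} u"
    proof (rule lipschitz_onI[OF _ lam])
      fix y y' assume y: "y \<in> {c..d}" "y' \<in> {c..d}"
      show "dist (u y) (u y') \<le> \<alpha> * dist y y'"
        using slope[of "T y" "T y'"] T[OF y(1)] T[OF y(2)] by (simp add: u_def dist_real_def)
    qed
    have \<phi>: "\<phi> (w s, s) = (X s, Y s)" for s by (simp add: X_def Y_def)
    show "\<phi> ` vertical_graph p q w = vertical_graph c d u"
    proof (intro equalityI subsetI)
      fix z assume "z \<in> \<phi> ` vertical_graph p q w"
      then obtain s where s: "s \<in> {p..q}" "z = (X s, Y s)" by (auto simp: vertical_graph_def \<phi>)
      hence "z = (u (Y s), Y s)" "Y s \<in> {c..d}" using TY img by (auto simp: u_def)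
      thus "z \<in> vertical_graph c d u" by (auto simp: vertical_graph_def)
    next
      fix z assume "z \<in> vertical_graph c d u"
      then obtain y where y: "y \<in> {c..d}" "z = (u y, y)" by (auto simp: vertical_graph_def)
      hence "z = \<phi> (w (T y), T y)" using T[OF y(1)] by (simp add: \<phi> u_def)
      thus "z \<in> \<phi> ` vertical_graph p q w" using T(1)[OF y(1)] by (auto simp: vertical_graph_def)
    qed
  qed
qed

lemma cone_expanding_subset:
  "cone_expanding \<alpha> \<mu> \<phi> K \<Longrightarrow> K' \<subseteq> K \<Longrightarrow> cone_expanding \<alpha> \<mu> \<phi> K'"
  unfolding cone_expanding_def
  by (meson continuous_on_subset has_derivative_subset subsetD)

section \<open>Strips as families of Lipschitz curves\<close>

text \<open>
  The part of the notion of strip that is the same for horizontal and vertical strips, so that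
  a strip can be turned by exchanging coordinates.
\<close>

definition lipschitz_strip :: "real \<Rightarrow> strip \<Rightarrow> bool" where
  "lipschitz_strip \<alpha> S \<longleftrightarrow> lo S < hi S \<and>
     \<alpha>-lipschitz_on {lo S..hi S} (curve1 S) \<and> \<alpha>-lipschitz_on {lo S..hi S} (curve2 S) \<and>
     (\<forall>t\<in>{lo S..hi S}. curve1 S t < curve2 S t)"

lemma lipschitz_strip_width_ge:
  assumes "lipschitz_strip \<alpha> S" "t \<in> {lo S..hi S}"
  shows "curve2 S t - curve1 S t \<le> width S"
proof -
  have "continuous_on {lo S..hi S} (\<lambda>t. \<bar>curve2 S t - curve1 S t\<bar>)"
    using assms unfolding lipschitz_strip_def
    by (intro continuous_intros) (auto dest: lipschitz_on_continuous_on)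
  hence "bdd_above ((\<lambda>t. \<bar>curve2 S t - curve1 S t\<bar>) ` {lo S..hi S})"
    by (intro bounded_imp_bdd_above compact_imp_bounded compact_continuous_image) auto
  hence "\<bar>curve2 S t - curve1 S t\<bar> \<le> width S"
    unfolding width_def using assms(2) by (rule cSUP_upper[rotated])
  thus ?thesis by simp
qed

lemma strip_width_le:
  assumes "lo S \<le> hi S" "\<And>t. t \<in> {lo S..hi S} \<Longrightarrow> \<bar>curve2 S t - curve1 S t\<bar> \<le> c"
  shows "width S \<le> c"
  unfolding width_def using assms by (intro cSUP_least) auto

text \<open>
  The convex combinations of the two bounding curves of a strip foliate it by Lipschitz curves
  with the same constant.
\<close>

definition mix :: "real \<Rightarrow> (real \<Rightarrow> real) \<Rightarrow> (real \<Rightarrow> real) \<Rightarrow> real \<Rightarrow> real" where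
  "mix t g0 g1 x = (1 - t) * g0 x + t * g1 x"

lemma mix_lipschitz:
  assumes "\<alpha>-lipschitz_on X g0" "\<alpha>-lipschitz_on X g1" "t \<in> {0..1}"
  shows "\<alpha>-lipschitz_on X (mix t g0 g1)"
proof -
  have *: "\<alpha>-lipschitz_on X ((\<lambda>x. (1 - t) * g0 x + t * g1 x))"
  proof (rule lipschitz_onI)
    fix x y assume xy: "x \<in> X" "y \<in> X"
    have "\<bar>(1 - t) * g0 x + t * g1 x - ((1 - t) * g0 y + t * g1 y)\<bar>
        = \<bar>(1 - t) * (g0 x - g0 y) + t * (g1 x - g1 y)\<bar>" by (simp add: algebra_simps)
    also have "\<dots> \<le> (1 - t) * \<bar>g0 x - g0 y\<bar> + t * \<bar>g1 x - g1 y\<bar>"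
      using abs_triangle_ineq[of "(1 - t) * (g0 x - g0 y)" "t * (g1 x - g1 y)"] assms(3)
      by (simp add: abs_mult)
    also have "\<dots> \<le> (1 - t) * (\<alpha> * \<bar>x - y\<bar>) + t * (\<alpha> * \<bar>x - y\<bar>)"
      using lipschitz_onD[OF assms(1) xy] lipschitz_onD[OF assms(2) xy] assms(3)
      by (intro add_mono mult_left_mono) (auto simp: dist_real_def)
    also have "\<dots> = \<alpha> * \<bar>x - y\<bar>" by (simp add: algebra_simps)
    finally show "dist ((1 - t) * g0 x + t * g1 x) ((1 - t) * g0 y + t * g1 y) \<le> \<alpha> * dist x y"
      by (simp add: dist_real_def)
  qed (use assms in \<open>simp add: lipschitz_on_def\<close>)
  have "mix t g0 g1 = (\<lambda>x. (1 - t) * g0 x + t * g1 x)" by (simp add: mix_def fun_eq_iff)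
  thus ?thesis using * by simp
qed

lemma mix_eq: "mix t g0 g1 x = g0 x + t * (g1 x - g0 x)"
  by (simp add: mix_def algebra_simps)

lemma mix_bounds:
  assumes "g0 x \<le> g1 x" "t \<in> {0..1}"
  shows "g0 x \<le> mix t g0 g1 x" "mix t g0 g1 x \<le> g1 x"
  using assms mult_left_le_one_le[of "g1 x - g0 x" t] by (auto simp: mix_eq)

lemma mix_through:
  assumes "g0 x < g1 x" "y \<in> {g0 x..g1 x}"
  shows "(y - g0 x) / (g1 x - g0 x) \<in> {0..1}" "mix ((y - g0 x) / (g1 x - g0 x)) g0 g1 x = y"
  using assms by (auto simp: mix_eq)

lemma vset_compact:
  assumes "lipschitz_strip \<alpha> S"
  shows "compact (vset S)"
proof -
  let ?F = "\<lambda>(y, t). (mix t (curve1 S) (curve2 S) y, y)"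
  let ?A = "{lo S..hi S} \<times> {0..1::real}"
  have c: "continuous_on ?A (\<lambda>z. g (fst z) :: real)"
    if "\<alpha>-lipschitz_on {lo S..hi S} g" for g
    by (rule continuous_on_compose2[OF lipschitz_on_continuous_on[OF that]])
       (auto intro!: continuous_intros)
  have "continuous_on ?A ?F"
    using assms unfolding case_prod_unfold mix_def lipschitz_strip_def
    by (intro continuous_intros c) auto
  hence "compact (?F ` ?A)" by (intro compact_continuous_image compact_Times) auto
  also have "?F ` ?A = vset S"
  proof (intro equalityI subsetI)
    fix z assume "z \<in> vset S"
    then obtain x y where z: "z = (x, y)" "y \<in> {lo S..hi S}" "x \<in> {curve1 S y..curve2 S y}"
      by (auto simp: vset_def)
    have less: "curve1 S y < curve2 S y" using assms z(2) by (simp add: lipschitz_strip_def)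
    show "z \<in> ?F ` ?A"
      using mix_through[of "curve1 S" y "curve2 S" x, OF less z(3)] z(1,2) by force
  next
    fix z assume "z \<in> ?F ` ?A"
    then obtain y t where z: "z = (mix t (curve1 S) (curve2 S) y, y)" "y \<in> {lo S..hi S}" "t \<in> {0..1}"
      by auto
    have "curve1 S y < curve2 S y" using assms z(2) by (simp add: lipschitz_strip_def)
    thus "z \<in> vset S" using mix_bounds[of "curve1 S" y "curve2 S" t] z by (auto simp: vset_def)
  qed
  finally show ?thesis .
qed

section \<open>The graph transform of a strip\<close>

text \<open>
  If every curve of the strip \<open>W\<close> crosses \<open>K\<close> in one arc whose ends are mapped to height \<open>c\<close> or
  \<open>d\<close>, then expansion puts the two ends at different heights and the arc is mapped to a graph over
  the whole interval \<open>{c..d}\<close>. The images of the leaves \<open>w t\<close> of \<open>W\<close> are disjoint, and at a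
  fixed height their position depends continuously on \<open>t\<close>; they fill the region between
  the images of the two boundary curves, which is therefore a strip. The map may reverse
  left and right, which is why the boundary curves are matched only as an unordered pair.

  For the width, the horizontal segment between the two boundary curves of the image is mapped
  by \<open>\<psi>\<close> to a curve of slope at most \<open>\<beta>\<close> that joins the boundary curves of \<open>W\<close> and is longer by at least a
  factor \<open>1 / \<mu>\<close>. Its horizontal extent is at most the width of \<open>W\<close> plus \<open>\<alpha> * \<beta>\<close>
  times itself, which gives the factor \<open>\<mu> / (1 - \<alpha> * \<beta>)\<close>.
\<close>

lemma strip_transform:
  fixes W :: strip
  assumes W: "lipschitz_strip \<alpha> W" and K: "compact K"
    and hom: "homeomorphism K B \<phi> \<psi>"
    and exp: "cone_expanding \<alpha> \<mu> \<phi> K"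
    and exp': "cone_expanding \<beta> \<mu> (prod.swap \<circ> \<psi> \<circ> prod.swap) (prod.swap ` B)"
    and \<mu>: "0 < \<mu>" and \<beta>: "0 \<le> \<beta>" and \<alpha>\<beta>: "\<alpha> * \<beta> < 1" and cd: "c < d"
    and cross: "\<And>w. \<alpha>-lipschitz_on {lo W..hi W} w \<Longrightarrow>
        (\<And>y. y \<in> {lo W..hi W} \<Longrightarrow> w y \<in> {curve1 W y..curve2 W y}) \<Longrightarrow>
        \<exists>p q. p < q \<and> {y \<in> {lo W..hi W}. (w y, y) \<in> K} = {p..q} \<and>
              snd (\<phi> (w p, p)) \<in> {c, d} \<and> snd (\<phi> (w q, q)) \<in> {c, d}"
  obtains S where "lo S = c" "hi S = d" "lipschitz_strip \<alpha> S"
    "vset S = \<phi> ` (K \<inter> vset W)"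
    "vertical_graph c d (curve1 S) \<union> vertical_graph c d (curve2 S)
       = \<phi> ` (K \<inter> (vertical_graph (lo W) (hi W) (curve1 W) \<union> vertical_graph (lo W) (hi W) (curve2 W)))"
    "width S \<le> \<mu> / (1 - \<alpha> * \<beta>) * width W"
proof -
  define a where "a = lo W"
  define b where "b = hi W"
  define w where "w t = mix t (curve1 W) (curve2 W)" for t
  have lips: "\<alpha>-lipschitz_on {a..b} (curve1 W)" "\<alpha>-lipschitz_on {a..b} (curve2 W)"
    and less: "\<And>y. y \<in> {a..b} \<Longrightarrow> curve1 W y < curve2 W y"
    using W by (auto simp: lipschitz_strip_def a_def b_def)
  have \<psi>\<phi>: "\<And>z. z \<in> K \<Longrightarrow> \<psi> (\<phi> z) = z" and img: "\<phi> ` K = B"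
    and cont\<phi>: "continuous_on K \<phi>" and cont\<psi>: "continuous_on B \<psi>"
    using hom by (auto simp: homeomorphism_def)
  have "\<exists>u. \<alpha>-lipschitz_on {c..d} u \<and> \<phi> ` (K \<inter> vertical_graph a b (w t)) = vertical_graph c d u"
    if t: "t \<in> {0..1}" for t
  proof -
    have lip: "\<alpha>-lipschitz_on {a..b} (w t)" unfolding w_def using mix_lipschitz lips t by blast
    have between: "w t y \<in> {curve1 W y..curve2 W y}" if "y \<in> {a..b}" for y
      using mix_bounds[of "curve1 W" y "curve2 W" t] less[OF that] t by (simp add: w_def)
    from cross[folded a_def b_def, OF lip between]
    obtain p q where pq: "p < q" "{y \<in> {a..b}. (w t y, y) \<in> K} = {p..q}"
      "snd (\<phi> (w t p, p)) \<in> {c, d}" "snd (\<phi> (w t q, q)) \<in> {c, d}"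
      by blast
    have part: "K \<inter> vertical_graph a b (w t) = vertical_graph p q (w t)"
      unfolding vertical_graph_def pq(2)[symmetric] by auto
    have lip': "\<alpha>-lipschitz_on {p..q} (w t)"
      using lip by (rule lipschitz_on_subset) (use pq(2) in blast)
    have inK: "(w t y, y) \<in> K" if "y \<in> {p..q}" for y using that pq(2) by blast
    obtain u where "\<alpha>-lipschitz_on {c..d} u" "\<phi> ` vertical_graph p q (w t) = vertical_graph c d u"
      by (rule cone_expanding_graph_image[OF exp \<mu> lip' pq(1) inK cont\<phi> pq(3,4) cd])
    thus ?thesis unfolding part by blast
  qed
  hence "\<forall>t\<in>{0..1}. \<exists>u. \<alpha>-lipschitz_on {c..d} u \<and> \<phi> ` (K \<inter> vertical_graph a b (w t)) = vertical_graph c d u"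
    by blast
  from bchoice[OF this] obtain u where u_lip: "\<And>t. t \<in> {0..1} \<Longrightarrow> \<alpha>-lipschitz_on {c..d} (u t)"
    and u_img: "\<And>t. t \<in> {0..1} \<Longrightarrow> \<phi> ` (K \<inter> vertical_graph a b (w t)) = vertical_graph c d (u t)"
    by blast
  \<comment> \<open>The label of the leaf through a point of W.\<close>
  define \<tau> where "\<tau> z = (fst z - curve1 W (snd z)) / (curve2 W (snd z) - curve1 W (snd z))" for z
  have \<tau>_range: "\<tau> z \<in> {0..1}" "z \<in> vertical_graph a b (w (\<tau> z))" if zW: "z \<in> vset W" for z
  proof -
    obtain x y where z: "z = (x, y)" "y \<in> {a..b}" "x \<in> {curve1 W y..curve2 W y}"
      using zW by (auto simp: vset_def a_def b_def)
    show "\<tau> z \<in> {0..1}" "z \<in> vertical_graph a b (w (\<tau> z))"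
      using mix_through[of "curve1 W" y "curve2 W" x] less[OF z(2)] z by (auto simp: \<tau>_def w_def vertical_graph_def)
  qed
  have \<tau>_graph: "z \<in> vset W" "\<tau> z = t" if t: "t \<in> {0..1}" and z: "z \<in> vertical_graph a b (w t)" for t z
  proof -
    obtain y where y: "y \<in> {a..b}" "z = (w t y, y)" using z by (auto simp: vertical_graph_def)
    show "z \<in> vset W"
      using mix_bounds[of "curve1 W" y "curve2 W" t] less[OF y(1)] t y
      by (simp add: w_def vset_def a_def b_def)
    show "\<tau> z = t" using less[OF y(1)] y by (simp add: \<tau>_def w_def mix_eq)
  qed
  have \<tau>_cont: "continuous_on (vset W) \<tau>"
  proof -
    have c: "continuous_on (vset W) (\<lambda>z. g (snd z) :: real)"
      if "\<alpha>-lipschitz_on {a..b} g" for g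
      by (rule continuous_on_compose2[OF lipschitz_on_continuous_on[OF that]])
         (auto intro!: continuous_intros simp: vset_def a_def b_def)
    show ?thesis unfolding \<tau>_def
      by (intro continuous_intros c lips ballI) (use less in \<open>force simp: vset_def a_def b_def\<close>)
  qed
  define M where "M = \<phi> ` (K \<inter> vset W)"
  have M_sub: "M \<subseteq> B" using img by (auto simp: M_def)
  have \<psi>M: "\<psi> z \<in> vset W" if "z \<in> M" for z using that \<psi>\<phi> by (auto simp: M_def)
  have u_back: "\<psi> (u t y, y) \<in> vertical_graph a b (w t)" "(u t y, y) \<in> M"
    "\<tau> (\<psi> (u t y, y)) = t"
    if "t \<in> {0..1}" "y \<in> {c..d}" for t y
  proof -
    have "(u t y, y) \<in> \<phi> ` (K \<inter> vertical_graph a b (w t))"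
      unfolding u_img[OF that(1)] using that(2) by (auto simp: vertical_graph_def)
    then obtain z where z: "z \<in> K" "z \<in> vertical_graph a b (w t)" "(u t y, y) = \<phi> z" by blast
    show "\<psi> (u t y, y) \<in> vertical_graph a b (w t)" "\<tau> (\<psi> (u t y, y)) = t"
      using z \<psi>\<phi> \<tau>_graph(2)[OF that(1) z(2)] by auto
    show "(u t y, y) \<in> M" using z \<tau>_graph(1)[OF that(1) z(2)] by (simp add: M_def)
  qed
  have M_point: "y \<in> {c..d}" "x = u (\<tau> (\<psi> (x, y))) y" "\<tau> (\<psi> (x, y)) \<in> {0..1}"
    if xy: "(x, y) \<in> M" for x y
  proof -
    obtain z where z: "z \<in> K" "z \<in> vset W" "(x, y) = \<phi> z" using xy by (auto simp: M_def)
    have "(x, y) \<in> vertical_graph c d (u (\<tau> z))"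
      unfolding u_img[OF \<tau>_range(1)[OF z(2)], symmetric] using z \<tau>_range(2)[OF z(2)] by blast
    thus "y \<in> {c..d}" "x = u (\<tau> (\<psi> (x, y))) y" "\<tau> (\<psi> (x, y)) \<in> {0..1}"
      using z \<psi>\<phi> \<tau>_range(1)[OF z(2)] by (auto simp: vertical_graph_def)
  qed
  have "compact M" unfolding M_def
    using K compact_imp_closed[OF vset_compact[OF W]] cont\<phi>
    by (intro compact_continuous_image) (auto intro: continuous_on_subset compact_Int_closed)
  have slice: "{x. (x, y) \<in> M} = closed_segment (u 0 y) (u 1 y)" "u 0 y \<noteq> u 1 y"
    if y: "y \<in> {c..d}" for y
  proof -
    \<comment> \<open>On the compact slice ?X the label of the preimage is continuous and inverts t to u t y,
      so the latter is continuous as well.\<close>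
    let ?X = "{x. (x, y) \<in> M}"
    have "?X = fst ` (M \<inter> UNIV \<times> {y})" by force
    moreover have "compact \<dots>"
      using \<open>compact M\<close> by (intro compact_continuous_image compact_Int_closed closed_Times continuous_intros) auto
    ultimately have X: "compact ?X" by simp
    have "continuous_on ?X (\<lambda>x. \<tau> (\<psi> (x, y)))"
      by (rule continuous_on_compose2[OF \<tau>_cont], rule continuous_on_compose2[OF cont\<psi>])
         (use M_sub \<psi>M in \<open>auto intro!: continuous_intros\<close>)
    from continuous_on_inv[OF this X, of "\<lambda>t. u t y"] M_point(2)
    have "continuous_on ((\<lambda>x. \<tau> (\<psi> (x, y))) ` ?X) (\<lambda>t. u t y)" by simp
    moreover have T: "(\<lambda>x. \<tau> (\<psi> (x, y))) ` ?X = {0..1}"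
    proof (intro equalityI subsetI)
      fix t :: real assume "t \<in> {0..1}"
      from u_back[OF this y] show "t \<in> (\<lambda>x. \<tau> (\<psi> (x, y))) ` ?X" by force
    qed (use M_point in auto)
    ultimately have cont: "continuous_on {0..1} (\<lambda>t. u t y)" by simp
    have inj: "inj_on (\<lambda>t. u t y) {0..1}"
      by (rule inj_on_inverseI[of _ "\<lambda>x. \<tau> (\<psi> (x, y))"]) (use u_back(3) y in auto)
    have "(\<lambda>t. u t y) ` closed_segment 0 1 = closed_segment (u 0 y) (u 1 y)"
      by (rule continuous_injective_image_segment_1)
         (use cont inj in \<open>simp_all add: closed_segment_eq_real_ivl\<close>)
    moreover have "(\<lambda>t. u t y) ` {0..1} = ?X"
    proof (intro equalityI subsetI)
      fix x assume "x \<in> ?X"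
      with M_point[of x y] show "x \<in> (\<lambda>t. u t y) ` {0..1}" by blast
    qed (use u_back(2) y in auto)
    ultimately show "?X = closed_segment (u 0 y) (u 1 y)"
      by (simp add: closed_segment_eq_real_ivl)
    show "u 0 y \<noteq> u 1 y" using inj_onD[OF inj, of 0 1] by auto
  qed
  have "(\<forall>y\<in>{c..d}. u 0 y < u 1 y) \<or> (\<forall>y\<in>{c..d}. u 1 y < u 0 y)"
  proof (rule ccontr)
    assume "\<not> ?thesis"
    then obtain y y' where y: "y \<in> {c..d}" "y' \<in> {c..d}" "u 1 y - u 0 y \<le> 0" "0 \<le> u 1 y' - u 0 y'"
      by (auto simp: not_less)
    have "continuous_on {c..d} (\<lambda>y. u 1 y - u 0 y)"
      using u_lip[of 0] u_lip[of 1] by (intro continuous_intros) (auto dest: lipschitz_on_continuous_on)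
    hence "is_interval ((\<lambda>y. u 1 y - u 0 y) ` {c..d})"
      by (simp add: connected_continuous_image is_interval_connected_1)
    from mem_is_interval_1_I[OF this, of "u 1 y - u 0 y" "u 1 y' - u 0 y'" 0] y
    have "0 \<in> (\<lambda>y. u 1 y - u 0 y) ` {c..d}" by blast
    thus False using slice(2) by fastforce
  qed
  then obtain l r where lr: "{l, r} = {u 0, u 1}" "\<And>y. y \<in> {c..d} \<Longrightarrow> l y < r y"
  proof
    assume "\<forall>y\<in>{c..d}. u 0 y < u 1 y" thus thesis using that[of "u 0" "u 1"] by blast
  next
    assume "\<forall>y\<in>{c..d}. u 1 y < u 0 y" thus thesis using that[of "u 1" "u 0"] by blast
  qed
  define S where "S = Strip c d l r"
  have lr_lip: "\<alpha>-lipschitz_on {c..d} l" "\<alpha>-lipschitz_on {c..d} r"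
    using lr(1) u_lip[of 0] u_lip[of 1] by (auto simp: doubleton_eq_iff)
  have seg: "closed_segment (u 0 y) (u 1 y) = {l y..r y}" if "y \<in> {c..d}" for y
    using lr(1) lr(2)[OF that] by (auto simp: doubleton_eq_iff closed_segment_eq_real_ivl)
  show thesis
  proof
    show "lo S = c" "hi S = d" by (simp_all add: S_def)
    show "lipschitz_strip \<alpha> S"
      using lr(2) lr_lip cd by (simp add: lipschitz_strip_def S_def)
    show "vset S = \<phi> ` (K \<inter> vset W)"
    proof -
      have "(x, y) \<in> M \<longleftrightarrow> y \<in> {c..d} \<and> x \<in> {l y..r y}" for x y
        using M_point(1)[of x y] slice(1)[of y] seg[of y] by blast
      thus ?thesis unfolding M_def[symmetric] by (auto simp: vset_def S_def)
    qed
    have "w 0 = curve1 W" "w 1 = curve2 W" by (auto simp: w_def mix_def)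
    thus "vertical_graph c d (curve1 S) \<union> vertical_graph c d (curve2 S)
       = \<phi> ` (K \<inter> (vertical_graph (lo W) (hi W) (curve1 W) \<union> vertical_graph (lo W) (hi W) (curve2 W)))"
      using u_img[of 0] u_img[of 1] lr(1)
      by (auto simp: doubleton_eq_iff S_def a_def b_def Int_Un_distrib image_Un)
    show "width S \<le> \<mu> / (1 - \<alpha> * \<beta>) * width W"
    proof (rule strip_width_le)
      show "lo S \<le> hi S" using cd by (simp add: S_def)
      fix y assume "y \<in> {lo S..hi S}"
      hence y: "y \<in> {c..d}" by (simp add: S_def)
      obtain y0 y1 where y0: "y0 \<in> {a..b}" "\<psi> (u 0 y, y) = (curve1 W y0, y0)"
        and y1: "y1 \<in> {a..b}" "\<psi> (u 1 y, y) = (curve2 W y1, y1)"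
        using u_back(1)[of 0 y] u_back(1)[of 1 y] y by (auto simp: vertical_graph_def w_def mix_def)
      \<comment> \<open>Horizontal extent of the preimage of the segment from u 0 y to u 1 y.\<close>
      let ?D = "\<bar>curve1 W y0 - curve2 W y1\<bar>"
      have const: "\<beta>-lipschitz_on {l y..r y} (\<lambda>s. y)" using \<beta> by (simp add: lipschitz_on_def)
      have inB: "(y, s) \<in> prod.swap ` B" if "s \<in> {l y..r y}" for s
      proof -
        have "(s, y) \<in> M" using that slice(1)[OF y] seg[OF y] by blast
        thus ?thesis using M_sub by (force simp: image_iff)
      qed
      have "u 0 y \<in> {l y..r y}" "u 1 y \<in> {l y..r y}" using seg[OF y] by auto
      from cone_expanding_curve[OF exp' \<mu> const inB this] y0 y1
      have D: "\<bar>u 0 y - u 1 y\<bar> \<le> \<mu> * ?D" "\<bar>y0 - y1\<bar> \<le> \<beta> * ?D" by simp_all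
      have "\<bar>curve1 W y0 - curve1 W y1\<bar> \<le> \<alpha> * \<bar>y0 - y1\<bar>"
        using lipschitz_onD[OF lips(1) y0(1) y1(1)] by (simp add: dist_real_def)
      also have "\<dots> \<le> \<alpha> * (\<beta> * ?D)"
        using D(2) lips(1) by (intro mult_left_mono) (auto simp: lipschitz_on_def)
      finally have "?D \<le> \<alpha> * \<beta> * ?D + width W"
        using lipschitz_strip_width_ge[OF W, of y1] y1(1) less[OF y1(1)] by (simp add: a_def b_def)
      hence "?D * (1 - \<alpha> * \<beta>) \<le> width W" by (simp add: algebra_simps)
      hence "?D \<le> width W / (1 - \<alpha> * \<beta>)" using \<alpha>\<beta> by (simp add: pos_le_divide_eq)
      hence "\<mu> * ?D \<le> \<mu> * (width W / (1 - \<alpha> * \<beta>))" using \<mu> by (intro mult_left_mono) auto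
      moreover have "\<bar>r y - l y\<bar> = \<bar>u 0 y - u 1 y\<bar>"
        using lr(1) by (auto simp: doubleton_eq_iff abs_minus_commute)
      ultimately show "\<bar>curve2 S y - curve1 S y\<bar> \<le> \<mu> / (1 - \<alpha> * \<beta>) * width W"
        using D(1) by (simp add: S_def)
    qed
  qed
qed

section \<open>Crossings of strips\<close>

lemma frontier_real_interval: "a < b \<Longrightarrow> frontier {a..b} = {a, b :: real}"
  by (auto simp: frontier_def)

lemma swap_vset: "prod.swap ` vset S = hset S" and swap_hset: "prod.swap ` hset S = vset S"
  by (force simp: vset_def hset_def image_iff)+

lemma hset_compact: "lipschitz_strip \<alpha> S \<Longrightarrow> compact (hset S)"
  unfolding swap_vset[symmetric]
  by (intro compact_continuous_image vset_compact continuous_intros) 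

text \<open>
  For a horizontal curve \<open>g\<close>, the function \<open>y - g (w y)\<close> is strictly increasing since
  \<open>\<alpha> * \<beta> < 1\<close>, so the vertical curve \<open>w\<close> crosses each boundary curve of \<open>G\<close> exactly once,
  and it is inside \<open>G\<close> exactly between these crossings. As \<open>w\<close> may leave the interval over
  which \<open>G\<close> lives, its values are first retracted to that interval by \<open>cl\<close>; the assumption
  \<open>inside\<close> says that this changes nothing between the crossings.
\<close>

lemma curve_crosses_strip:
  assumes G: "lipschitz_strip \<beta> G" and w: "\<alpha>-lipschitz_on {a..b} w"
    and \<alpha>\<beta>: "\<alpha> * \<beta> < 1" and ab: "a \<le> b"
    and cl: "cl = (\<lambda>x. max (lo G) (min (hi G) x))"
    and bottom: "a \<le> curve1 G (cl (w a))" and top: "curve2 G (cl (w b)) \<le> b"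
    and inside: "\<And>y. y \<in> {a..b} \<Longrightarrow> curve1 G (cl (w y)) \<le> y \<Longrightarrow> y \<le> curve2 G (cl (w y))
        \<Longrightarrow> w y \<in> {lo G..hi G}"
  obtains p q where "p < q" "{y \<in> {a..b}. (w y, y) \<in> hset G} = {p..q}"
    "(w p, p) \<in> horizontal_graph (lo G) (hi G) (curve1 G)"
    "(w q, q) \<in> horizontal_graph (lo G) (hi G) (curve2 G)"
proof -
  have lohi: "lo G < hi G" and G_lip: "\<beta>-lipschitz_on {lo G..hi G} (curve1 G)" "\<beta>-lipschitz_on {lo G..hi G} (curve2 G)"
    and less: "\<And>x. x \<in> {lo G..hi G} \<Longrightarrow> curve1 G x < curve2 G x"
    using G by (auto simp: lipschitz_strip_def)
  have cl_in: "cl x \<in> {lo G..hi G}" and cl_id: "x \<in> {lo G..hi G} \<Longrightarrow> cl x = x" for x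
    using lohi by (auto simp: cl)
  have cl_contr: "\<bar>cl x - cl y\<bar> \<le> \<bar>x - y\<bar>" for x y by (auto simp: cl max_def min_def)
  have \<beta>: "0 \<le> \<beta>" using G_lip by (simp add: lipschitz_on_def)
  have lip: "\<bar>g (cl (w y)) - g (cl (w y'))\<bar> \<le> \<alpha> * \<beta> * \<bar>y - y'\<bar>"
    if "\<beta>-lipschitz_on {lo G..hi G} g" "y \<in> {a..b}" "y' \<in> {a..b}" for g y y'
  proof -
    have "\<bar>g (cl (w y)) - g (cl (w y'))\<bar> \<le> \<beta> * \<bar>cl (w y) - cl (w y')\<bar>"
      using lipschitz_onD[OF that(1) cl_in cl_in] by (simp add: dist_real_def)
    also have "\<dots> \<le> \<beta> * \<bar>w y - w y'\<bar>" using cl_contr \<beta> by (intro mult_left_mono) auto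
    also have "\<dots> \<le> \<beta> * (\<alpha> * \<bar>y - y'\<bar>)"
      using lipschitz_onD[OF w that(2,3)] \<beta> by (intro mult_left_mono) (auto simp: dist_real_def)
    finally show ?thesis by (simp add: mult_ac)
  qed
  have increasing: "y - g (cl (w y)) < y' - g (cl (w y'))"
    if g: "\<beta>-lipschitz_on {lo G..hi G} g" and y: "y \<in> {a..b}" "y' \<in> {a..b}" "y < y'" for g y y'
  proof -
    have "\<alpha> * \<beta> * (y' - y) < 1 * (y' - y)" using \<alpha>\<beta> y(3) by (intro mult_strict_right_mono) auto
    moreover have "g (cl (w y')) - g (cl (w y)) \<le> \<alpha> * \<beta> * (y' - y)"
      using lip[OF g y(1,2)] y(3) by (simp add: abs_le_iff)
    ultimately have "g (cl (w y')) - g (cl (w y)) < 1 * (y' - y)" by (rule le_less_trans[rotated])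
    thus ?thesis by simp
  qed
  have root: "\<exists>p. a \<le> p \<and> p \<le> b \<and> p - g (cl (w p)) = 0"
    if g: "\<beta>-lipschitz_on {lo G..hi G} g" and "a - g (cl (w a)) \<le> 0" "0 \<le> b - g (cl (w b))" for g
  proof (rule IVT'[OF that(2,3) ab])
    have "(\<alpha> * \<beta>)-lipschitz_on {a..b} (\<lambda>y. g (cl (w y)))"
      using lip[OF g] w \<beta> by (auto simp: lipschitz_on_def dist_real_def)
    thus "continuous_on {a..b} (\<lambda>y. y - g (cl (w y)))"
      by (intro continuous_intros) (rule lipschitz_on_continuous_on)
  qed
  have less': "curve1 G (cl x) < curve2 G (cl x)" for x using less cl_in by blast
  obtain p where p: "p \<in> {a..b}" "p = curve1 G (cl (w p))"
    using root[OF G_lip(1)] bottom top less'[of "w b"] by auto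
  obtain q where q: "q \<in> {a..b}" "q = curve2 G (cl (w q))"
    using root[OF G_lip(2)] bottom top less'[of "w a"] by auto
  have below: "curve1 G (cl (w y)) \<le> y \<longleftrightarrow> p \<le> y" if "y \<in> {a..b}" for y
    using increasing[OF G_lip(1) p(1) that] increasing[OF G_lip(1) that p(1)] p(2) by fastforce
  have above: "y \<le> curve2 G (cl (w y)) \<longleftrightarrow> y \<le> q" if "y \<in> {a..b}" for y
    using increasing[OF G_lip(2) q(1) that] increasing[OF G_lip(2) that q(1)] q(2) by fastforce
  have "p < q"
  proof (rule ccontr)
    assume "\<not> p < q"
    hence "curve1 G (cl (w q)) \<ge> q" using below[OF q(1)] p(2) by fastforce
    thus False using less'[of "w q"] q(2) by simp
  qed
  moreover have "{y \<in> {a..b}. (w y, y) \<in> hset G} = {p..q}"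
  proof (intro equalityI subsetI)
    fix y assume "y \<in> {y \<in> {a..b}. (w y, y) \<in> hset G}"
    hence y: "y \<in> {a..b}" "w y \<in> {lo G..hi G}" "curve1 G (w y) \<le> y" "y \<le> curve2 G (w y)"
      by (auto simp: hset_def)
    thus "y \<in> {p..q}" using below[OF y(1)] above[OF y(1)] cl_id[OF y(2)] by simp
  next
    fix y assume y: "y \<in> {p..q}"
    hence y': "y \<in> {a..b}" using p(1) q(1) by auto
    hence "curve1 G (cl (w y)) \<le> y" "y \<le> curve2 G (cl (w y))" using y below above by auto
    thus "y \<in> {y \<in> {a..b}. (w y, y) \<in> hset G}"
      using inside[OF y'] cl_id[of "w y"] y' by (auto simp: hset_def)
  qed
  moreover have "w p \<in> {lo G..hi G}" using inside[OF p(1)] p(2) less'[of "w p"] by simp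
  moreover have "w q \<in> {lo G..hi G}" using inside[OF q(1)] q(2) less'[of "w q"] by simp
  ultimately show thesis
    using that[of p q] p(2) q(2) cl_id[of "w p"] cl_id[of "w q"]
    by (simp add: horizontal_graph_def)
qed

text \<open>
  Strictly between the curves and strictly between the end heights, a point is interior.
\<close>

lemma vstrip_vbd_on_curves:
  assumes V: "lipschitz_strip \<alpha> V" and z: "(x, y) \<in> vstrip_vbd V" "(x, y) \<in> vset V"
  shows "x = curve1 V y \<or> x = curve2 V y"
proof (rule ccontr)
  assume neq: "\<not> ?thesis"
  have lohi: "lo V < hi V" using V by (simp add: lipschitz_strip_def)
  hence "frontier {lo V..hi V} = {lo V, hi V}" by (rule frontier_real_interval)
  hence y: "y \<in> {lo V<..<hi V}" and x: "curve1 V y < x" "x < curve2 V y"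
    using z neq by (auto simp: vstrip_vbd_def vstrip_hbd_def vset_def)
  define O1 where "O1 = (UNIV :: real set) \<times> {lo V<..<hi V}"
  have op: "open O1" by (simp add: O1_def open_Times)
  have c: "continuous_on O1 (\<lambda>z. g (snd z) :: real)" if "\<alpha>-lipschitz_on {lo V..hi V} g" for g
    by (rule continuous_on_compose2[OF lipschitz_on_continuous_on[OF that]])
       (auto intro!: continuous_intros simp: O1_def)
  have "continuous_on O1 (\<lambda>z. fst z - curve1 V (snd z))" "continuous_on O1 (\<lambda>z. curve2 V (snd z) - fst z)"
    using V c unfolding lipschitz_strip_def by (auto intro!: continuous_intros)
  hence "open ((O1 \<inter> (\<lambda>z. fst z - curve1 V (snd z)) -` {0<..}) \<inter> (O1 \<inter> (\<lambda>z. curve2 V (snd z) - fst z) -` {0<..}))"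
    (is "open ?O") by (intro open_Int continuous_open_preimage op) auto
  moreover have "?O \<subseteq> vset V" by (auto simp: O1_def vset_def)
  moreover have "(x, y) \<in> ?O" using x y by (simp add: O1_def)
  ultimately have "(x, y) \<in> interior (vset V)" by (meson interior_maximal subsetD)
  thus False using z(1) by (simp add: vstrip_vbd_def frontier_def)
qed

text \<open>
  Each side of the horizontal strip \<open>G\<close> is a vertical segment contained in the union of the two
  boundary curves of \<open>V\<close>. A horizontal curve in \<open>G\<close> cannot meet the same boundary curve of \<open>V\<close>
  twice because \<open>\<alpha> * \<beta> < 1\<close>. So the left side of \<open>G\<close> lies on the left curve and the
  right side on the right curve, and \<open>G\<close> meets these curves nowhere else.
\<close>

lemma strip_sides:
  assumes V: "lipschitz_strip \<alpha> V" and G: "lipschitz_strip \<beta> G" and \<alpha>\<beta>: "\<alpha> * \<beta> < 1"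
    and sub: "hset G \<subseteq> vset V" and vbd: "hstrip_vbd G \<subseteq> vstrip_vbd V"
  shows strip_sides_left: "y \<in> {curve1 G (lo G)..curve2 G (lo G)} \<Longrightarrow> curve1 V y = lo G"
    and strip_sides_right: "y \<in> {curve1 G (hi G)..curve2 G (hi G)} \<Longrightarrow> curve2 V y = hi G"
    and strip_meets_left: "(x, z) \<in> hset G \<Longrightarrow> x = curve1 V z \<Longrightarrow> x = lo G"
    and strip_meets_right: "(x, z) \<in> hset G \<Longrightarrow> x = curve2 V z \<Longrightarrow> x = hi G"
proof -
  have lohi: "lo G < hi G" and G_lip: "\<beta>-lipschitz_on {lo G..hi G} (curve1 G)" "\<beta>-lipschitz_on {lo G..hi G} (curve2 G)"
    and less: "\<And>x. x \<in> {lo G..hi G} \<Longrightarrow> curve1 G x < curve2 G x"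
    using G by (auto simp: lipschitz_strip_def)
  have V_lip: "\<alpha>-lipschitz_on {lo V..hi V} (curve1 V)" "\<alpha>-lipschitz_on {lo V..hi V} (curve2 V)"
    using V by (auto simp: lipschitz_strip_def)
  hence \<alpha>: "0 \<le> \<alpha>" by (simp add: lipschitz_on_def)
  have through: "\<exists>g. \<beta>-lipschitz_on {lo G..hi G} g \<and> g x = y \<and>
      (\<forall>x'\<in>{lo G..hi G}. (x', g x') \<in> hset G)" if xy: "(x, y) \<in> hset G" for x y
  proof -
    have x: "x \<in> {lo G..hi G}" "y \<in> {curve1 G x..curve2 G x}" using xy by (auto simp: hset_def)
    from mix_through[of "curve1 G" x "curve2 G" y, OF less[OF x(1)] x(2)] obtain t
      where t: "t \<in> {0..1}" "mix t (curve1 G) (curve2 G) x = y" by blast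
    have "(x', mix t (curve1 G) (curve2 G) x') \<in> hset G" if "x' \<in> {lo G..hi G}" for x'
      using mix_bounds[of "curve1 G" x' "curve2 G" t] less[OF that] t(1) that by (auto simp: hset_def)
    thus ?thesis using mix_lipschitz[OF G_lip t(1)] t(2) by blast
  qed
  have comp: "\<bar>v (g x) - v (g x')\<bar> \<le> \<alpha> * \<beta> * \<bar>x - x'\<bar>"
    if "\<alpha>-lipschitz_on {lo V..hi V} v" "\<beta>-lipschitz_on {lo G..hi G} g"
       "\<forall>x\<in>{lo G..hi G}. (x, g x) \<in> hset G" "x \<in> {lo G..hi G}" "x' \<in> {lo G..hi G}" for v g x x'
  proof -
    have "g x \<in> {lo V..hi V}" "g x' \<in> {lo V..hi V}" using that sub by (auto simp: vset_def)
    hence "\<bar>v (g x) - v (g x')\<bar> \<le> \<alpha> * \<bar>g x - g x'\<bar>"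
      using lipschitz_onD[OF that(1)] by (simp add: dist_real_def)
    also have "\<dots> \<le> \<alpha> * (\<beta> * \<bar>x - x'\<bar>)"
      using lipschitz_onD[OF that(2,4,5)] \<alpha> by (intro mult_left_mono) (auto simp: dist_real_def)
    finally show ?thesis by simp
  qed
  have contr: "x = x'" if "\<bar>x - x'\<bar> \<le> \<alpha> * \<beta> * \<bar>x - x'\<bar>" for x x' :: real
  proof (rule ccontr)
    assume "x \<noteq> x'"
    hence "\<alpha> * \<beta> * \<bar>x - x'\<bar> < 1 * \<bar>x - x'\<bar>" using \<alpha>\<beta> by (intro mult_strict_right_mono) auto
    thus False using that by simp
  qed
  have fr: "frontier {lo G..hi G} = {lo G, hi G}" using frontier_real_interval[OF lohi] .
  have side: "x = curve1 V y \<or> x = curve2 V y" if "(x, y) \<in> hset G" "x \<in> {lo G, hi G}" for x y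
    using vstrip_vbd_on_curves[OF V, of x y] that sub vbd fr by (auto simp: hstrip_vbd_def)
  have V_bounds: "curve1 V (g x) \<le> x" "x \<le> curve2 V (g x)"
    if "\<forall>x\<in>{lo G..hi G}. (x, g x) \<in> hset G" "x \<in> {lo G..hi G}" for g x
    using that sub by (auto simp: vset_def)
  have ends: "curve1 V (g (lo G)) = lo G" "curve2 V (g (hi G)) = hi G"
    if g: "\<beta>-lipschitz_on {lo G..hi G} g" "\<forall>x\<in>{lo G..hi G}. (x, g x) \<in> hset G" for g
  proof -
    have lohi_in: "lo G \<in> {lo G..hi G}" "hi G \<in> {lo G..hi G}" using lohi by auto
    show "curve1 V (g (lo G)) = lo G"
    proof (rule ccontr)
      assume "curve1 V (g (lo G)) \<noteq> lo G"
      hence "curve2 V (g (lo G)) = lo G" using side[of "lo G" "g (lo G)"] g(2) lohi_in by auto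
      hence "hi G = lo G"
        using V_bounds(2)[OF g(2) lohi_in(2)] lohi
        by (intro contr order_trans[OF _ comp[OF V_lip(2) g lohi_in(2,1)]]) auto
      thus False using lohi by simp
    qed
    show "curve2 V (g (hi G)) = hi G"
    proof (rule ccontr)
      assume "curve2 V (g (hi G)) \<noteq> hi G"
      hence "curve1 V (g (hi G)) = hi G" using side[of "hi G" "g (hi G)"] g(2) lohi_in by auto
      hence "hi G = lo G"
        using V_bounds(1)[OF g(2) lohi_in(1)] lohi
        by (intro contr order_trans[OF _ comp[OF V_lip(1) g lohi_in(2,1)]]) auto
      thus False using lohi by simp
    qed
  qed
  show "curve1 V y = lo G" if "y \<in> {curve1 G (lo G)..curve2 G (lo G)}"
  proof -
    have "(lo G, y) \<in> hset G" using that lohi by (simp add: hset_def)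
    from through[OF this] ends(1) show ?thesis by blast
  qed
  show "curve2 V y = hi G" if "y \<in> {curve1 G (hi G)..curve2 G (hi G)}"
  proof -
    have "(hi G, y) \<in> hset G" using that lohi by (simp add: hset_def)
    from through[OF this] ends(2) show ?thesis by blast
  qed
  show "x = lo G" if xz: "(x, z) \<in> hset G" "x = curve1 V z"
  proof -
    obtain g where g: "\<beta>-lipschitz_on {lo G..hi G} g" "\<forall>x\<in>{lo G..hi G}. (x, g x) \<in> hset G" "g x = z"
      using through[OF xz(1)] by blast
    have x: "x \<in> {lo G..hi G}" using xz by (auto simp: hset_def)
    show ?thesis
      using comp[OF V_lip(1) g(1,2) x, of "lo G"] ends(1)[OF g(1,2)] g(3) xz(2) lohi
      by (intro contr) simp
  qed
  show "x = hi G" if xz: "(x, z) \<in> hset G" "x = curve2 V z"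
  proof -
    obtain g where g: "\<beta>-lipschitz_on {lo G..hi G} g" "\<forall>x\<in>{lo G..hi G}. (x, g x) \<in> hset G" "g x = z"
      using through[OF xz(1)] by blast
    have x: "x \<in> {lo G..hi G}" using xz by (auto simp: hset_def)
    show ?thesis
      using comp[OF V_lip(2) g(1,2) x, of "hi G"] ends(2)[OF g(1,2)] g(3) xz(2) lohi
      by (intro contr) simp
  qed
qed

text \<open>
  The corners are excluded: they belong to the vertical boundary.
\<close>

lemma hstrip_hbd_curves:
  assumes G: "lipschitz_strip \<alpha> G" and x: "x \<in> {lo G<..<hi G}"
  shows "(x, curve1 G x) \<in> hstrip_hbd G" "(x, curve2 G x) \<in> hstrip_hbd G"
proof -
  have less: "curve1 G x < curve2 G x" using G x by (simp add: lipschitz_strip_def)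
  have "frontier {lo G..hi G} = {lo G, hi G}" using x by (intro frontier_real_interval) simp
  hence nvbd: "(x, y) \<notin> hstrip_vbd G" for y using x by (auto simp: hstrip_vbd_def)
  have inG: "(x, y) \<in> hset G \<longleftrightarrow> y \<in> {curve1 G x..curve2 G x}" for y using x by (auto simp: hset_def)
  have "(x, y) \<in> hstrip_hbd G"
    if y: "y \<in> {curve1 G x, curve2 G x}" for y
  proof -
    have "(x, y) \<notin> interior (hset G)"
    proof
      assume "(x, y) \<in> interior (hset G)"
      then obtain e where e: "0 < e" "ball (x, y) e \<subseteq> hset G" by (auto simp: mem_interior)
      have "(x, y + e / 2) \<in> ball (x, y) e" "(x, y - e / 2) \<in> ball (x, y) e"
        using e(1) by (auto simp: dist_Pair_Pair dist_real_def)
      hence "(x, y + e / 2) \<in> hset G" "(x, y - e / 2) \<in> hset G" using e(2) by auto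
      thus False using inG y e(1) by auto
    qed
    moreover have "(x, y) \<in> closure (hset G)" using inG y less closure_subset by force
    ultimately show ?thesis using nvbd by (simp add: hstrip_hbd_def frontier_def)
  qed
  thus "(x, curve1 G x) \<in> hstrip_hbd G" "(x, curve2 G x) \<in> hstrip_hbd G" by auto
qed

section \<open>Preimages of vertical strips and images of horizontal strips\<close>

text \<open>
  The inverse branch \<open>g\<close> is applied to the part of a full vertical strip \<open>W\<close> that lies in
  the horizontal strip \<open>G\<close>. Every vertical curve in \<open>W\<close> crosses \<open>G\<close> from its lower to its upper
  boundary curve: the sides of \<open>G\<close> lie on the boundary of \<open>V\<close>, so the curve cannot pass beside \<open>G\<close>.
  The boundary curves of \<open>G\<close> are mapped to the bottom or top of \<open>V'\<close>, and expansion excludes that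
  both ends of a curve arrive at the same one, so the preimage of \<open>W\<close> has the full height of \<open>V'\<close>.
\<close>

lemma strip_pullback:
  assumes V: "lipschitz_strip \<alpha> V" and V': "lipschitz_strip \<alpha>' V'" and G: "lipschitz_strip \<beta> G"
    and \<alpha>\<beta>: "\<alpha> * \<beta> < 1" and \<mu>: "0 < \<mu>"
    and sub: "hset G \<subseteq> vset V" and vbd: "hstrip_vbd G \<subseteq> vstrip_vbd V"
    and hom: "homeomorphism (hset G) B g f"
    and exp: "cone_expanding \<alpha> \<mu> g (hset G)"
    and exp': "cone_expanding \<beta> \<mu> (prod.swap \<circ> f \<circ> prod.swap) (prod.swap ` B)"
    and hbd: "g ` hstrip_hbd G \<subseteq> vstrip_hbd V'"
    and W: "lipschitz_strip \<alpha> W" "lo W = lo V" "hi W = hi V" "vset W \<subseteq> vset V"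
  obtains S where "lo S = lo V'" "hi S = hi V'" "lipschitz_strip \<alpha> S"
    "vset S = g ` (hset G \<inter> vset W)"
    "vertical_graph (lo S) (hi S) (curve1 S) \<union> vertical_graph (lo S) (hi S) (curve2 S)
       = g ` (hset G \<inter> (vertical_graph (lo W) (hi W) (curve1 W) \<union> vertical_graph (lo W) (hi W) (curve2 W)))"
    "width S \<le> \<mu> / (1 - \<alpha> * \<beta>) * width W"
proof -
  have \<beta>: "0 \<le> \<beta>" using G by (simp add: lipschitz_strip_def lipschitz_on_def)
  have lohi: "lo G < hi G" and less: "\<And>x. x \<in> {lo G..hi G} \<Longrightarrow> curve1 G x < curve2 G x"
    and G_lip: "\<beta>-lipschitz_on {lo G..hi G} (curve1 G)" "\<beta>-lipschitz_on {lo G..hi G} (curve2 G)"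
    using G by (auto simp: lipschitz_strip_def)
  have V'_lohi: "lo V' < hi V'" using V' by (simp add: lipschitz_strip_def)
  have VW: "lo V < hi V" using V by (simp add: lipschitz_strip_def)
  have contg: "continuous_on (hset G) g" using hom by (simp add: homeomorphism_def)
  have height: "snd (g z) \<in> {lo V', hi V'}"
    if z: "z \<in> horizontal_graph (lo G) (hi G) h" and h: "h = curve1 G \<or> h = curve2 G" for z h
  proof -
    obtain x where x: "x \<in> {lo G..hi G}" "z = (x, h x)" using z by (auto simp: horizontal_graph_def)
    have h_lip: "\<beta>-lipschitz_on {lo G..hi G} h" using h G_lip by auto
    have h_in: "(t, h t) \<in> hset G" if "t \<in> {lo G..hi G}" for t
      using h less[OF that] that by (auto simp: hset_def)
    have "continuous_on {lo G..hi G} (\<lambda>t. g (t, h t))"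
    proof (rule continuous_on_compose2[OF contg])
      show "continuous_on {lo G..hi G} (\<lambda>t. (t, h t))"
        by (intro continuous_on_Pair continuous_on_id lipschitz_on_continuous_on[OF h_lip])
    qed (use h_in in auto)
    \<comment> \<open>The hypothesis on g covers the boundary curves without their end points; the end points
      follow by continuity.\<close>
    hence "continuous_on (closure {lo G<..<hi G}) (\<lambda>t. snd (g (t, h t)))"
      using lohi by (simp add: continuous_on_snd)
    moreover have "closed {lo V', hi V'}" by (intro finite_imp_closed) simp
    moreover have "(\<lambda>t. snd (g (t, h t))) ` {lo G<..<hi G} \<subseteq> {lo V', hi V'}"
    proof (rule image_subsetI)
      fix t assume t: "t \<in> {lo G<..<hi G}"
      have "(t, h t) \<in> hstrip_hbd G" using h hstrip_hbd_curves[OF G t] by (elim disjE) simp_all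
      hence "g (t, h t) \<in> vstrip_hbd V'" by (rule subsetD[OF hbd imageI])
      hence "snd (g (t, h t)) \<in> frontier {lo V'..hi V'}"
        unfolding vstrip_hbd_def by (simp add: case_prod_unfold)
      thus "snd (g (t, h t)) \<in> {lo V', hi V'}" unfolding frontier_real_interval[OF V'_lohi] .
    qed
    ultimately have "(\<lambda>t. snd (g (t, h t))) ` closure {lo G<..<hi G} \<subseteq> {lo V', hi V'}"
      by (rule image_closure_subset)
    from subsetD[OF this imageI, of x] show ?thesis using x lohi by simp
  qed
  obtain S where S: "lo S = lo V'" "hi S = hi V'" "lipschitz_strip \<alpha> S"
    "vset S = g ` (hset G \<inter> vset W)"
    "vertical_graph (lo V') (hi V') (curve1 S) \<union> vertical_graph (lo V') (hi V') (curve2 S)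
       = g ` (hset G \<inter> (vertical_graph (lo W) (hi W) (curve1 W) \<union> vertical_graph (lo W) (hi W) (curve2 W)))"
    "width S \<le> \<mu> / (1 - \<alpha> * \<beta>) * width W"
  proof (rule strip_transform[OF W(1) hset_compact[OF G] hom exp exp' \<mu> \<beta> \<alpha>\<beta> V'_lohi])
    fix w assume w: "\<alpha>-lipschitz_on {lo W..hi W} w"
      and between: "\<And>y. y \<in> {lo W..hi W} \<Longrightarrow> w y \<in> {curve1 W y..curve2 W y}"
    have wV: "curve1 V y \<le> w y" "w y \<le> curve2 V y" if "y \<in> {lo W..hi W}" for y
    proof -
      have "(w y, y) \<in> vset W" using between[OF that] that by (simp add: vset_def)
      hence "(w y, y) \<in> vset V" using W(4) by blast
      thus "curve1 V y \<le> w y" "w y \<le> curve2 V y" by (auto simp: vset_def)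
    qed
    define cl where "cl = (\<lambda>x. max (lo G) (min (hi G) x))"
    have cl: "cl x \<in> {lo G..hi G}" for x using lohi by (auto simp: cl_def)
    have G_in: "curve1 G x \<in> {lo W..hi W}" "curve2 G x \<in> {lo W..hi W}" if "x \<in> {lo G..hi G}" for x
    proof -
      have "(x, curve1 G x) \<in> hset G" "(x, curve2 G x) \<in> hset G"
        using less[OF that] that by (auto simp: hset_def)
      hence "(x, curve1 G x) \<in> vset V" "(x, curve2 G x) \<in> vset V" using sub by auto
      thus "curve1 G x \<in> {lo W..hi W}" "curve2 G x \<in> {lo W..hi W}" using W by (auto simp: vset_def)
    qed
    show "\<exists>p q. p < q \<and> {y \<in> {lo W..hi W}. (w y, y) \<in> hset G} = {p..q} \<and>
              snd (g (w p, p)) \<in> {lo V', hi V'} \<and> snd (g (w q, q)) \<in> {lo V', hi V'}"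
    proof (rule curve_crosses_strip[OF G w \<alpha>\<beta> _ cl_def])
      show "lo W \<le> hi W" using VW W by simp
      show "lo W \<le> curve1 G (cl (w (lo W)))" "curve2 G (cl (w (hi W))) \<le> hi W"
        using G_in[OF cl] by auto
      show "w y \<in> {lo G..hi G}"
        if y: "y \<in> {lo W..hi W}" "curve1 G (cl (w y)) \<le> y" "y \<le> curve2 G (cl (w y))" for y
      proof (rule ccontr)
        assume "w y \<notin> {lo G..hi G}"
        then consider "w y < lo G" | "hi G < w y" by fastforce
        thus False
        proof cases
          case 1
          hence "cl (w y) = lo G" using lohi by (simp add: cl_def)
          hence "curve1 V y = lo G" using strip_sides_left[OF V G \<alpha>\<beta> sub vbd] y by simp
          thus False using wV(1)[OF y(1)] 1 by simp
        next
          case 2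
          hence "cl (w y) = hi G" using lohi by (simp add: cl_def)
          hence "curve2 V y = hi G" using strip_sides_right[OF V G \<alpha>\<beta> sub vbd] y by simp
          thus False using wV(2)[OF y(1)] 2 by simp
        qed
      qed
    next
      fix p q
      assume pq: "p < q" "{y \<in> {lo W..hi W}. (w y, y) \<in> hset G} = {p..q}"
        "(w p, p) \<in> horizontal_graph (lo G) (hi G) (curve1 G)"
        "(w q, q) \<in> horizontal_graph (lo G) (hi G) (curve2 G)"
      show ?thesis
        using pq(1,2) height[OF pq(3) disjI1[OF refl]] height[OF pq(4) disjI2[OF refl]] by blast
    qed
  qed
  show thesis using that[of S] S by simp
qed

text \<open>
  This is the graph transform with exchanged coordinates, applied to the horizontal strip \<open>H\<close>
  and the vertical strip \<open>U\<close>, the domain of the branch \<open>f\<close>. The assumption \<open>sides\<close> provides the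
  ends of the image curves: the boundary curves of \<open>U\<close> are mapped into those of \<open>V'\<close>, and \<open>G\<close>
  meets the latter only in its own sides. Hence all images of curves in \<open>H\<close> are graphs over
  the interval of \<open>G\<close>.
\<close>

lemma strip_pushforward:
  assumes V: "lipschitz_strip \<alpha> V" and U: "lipschitz_strip \<alpha> U" and V': "lipschitz_strip \<alpha> V'"
    and G: "lipschitz_strip \<beta> G" and H: "lipschitz_strip \<beta> H"
    and \<alpha>\<beta>: "\<alpha> * \<beta> < 1" and \<mu>: "0 < \<mu>"
    and U_full: "lo U = lo V" "hi U = hi V" "vset U \<subseteq> vset V"
    and HV: "hset H \<subseteq> vset V" "hstrip_vbd H \<subseteq> vstrip_vbd V"
    and GV': "hset G \<subseteq> vset V'" "hstrip_vbd G \<subseteq> vstrip_vbd V'"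
    and hom: "homeomorphism (vset U) (hset G) f g"
    and exp: "cone_expanding \<beta> \<mu> (prod.swap \<circ> f \<circ> prod.swap) (prod.swap ` vset U)"
    and exp': "cone_expanding \<alpha> \<mu> g (hset G)"
    and sides: "f ` (vertical_graph (lo U) (hi U) (curve1 U) \<union> vertical_graph (lo U) (hi U) (curve2 U))
        \<subseteq> vertical_graph (lo V') (hi V') (curve1 V') \<union> vertical_graph (lo V') (hi V') (curve2 V')"
  obtains S where "lo S = lo G" "hi S = hi G" "lipschitz_strip \<beta> S"
    "hset S = f ` (vset U \<inter> hset H)"
    "width S \<le> \<mu> / (1 - \<alpha> * \<beta>) * width H"
proof -
  have \<alpha>: "0 \<le> \<alpha>" using V by (simp add: lipschitz_strip_def lipschitz_on_def)
  have G_lohi: "lo G < hi G" and H_lohi: "lo H < hi H"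
    using G H by (auto simp: lipschitz_strip_def)
  have U_less: "\<And>y. y \<in> {lo U..hi U} \<Longrightarrow> curve1 U y < curve2 U y"
    using U by (auto simp: lipschitz_strip_def)
  have hom': "homeomorphism (hset U) (vset G) (prod.swap \<circ> f \<circ> prod.swap) (prod.swap \<circ> g \<circ> prod.swap)"
  proof (rule homeomorphismI)
    have c: "continuous_on (vset U) f" "continuous_on (hset G) g" using hom by (auto simp: homeomorphism_def)
    have hom_img: "f ` vset U = hset G" "g ` hset G = vset U" using hom by (auto simp: homeomorphism_def)
    show "continuous_on (hset U) (prod.swap \<circ> f \<circ> prod.swap)" "continuous_on (vset G) (prod.swap \<circ> g \<circ> prod.swap)"
      by (intro continuous_on_compose continuous_on_swap; simp only: swap_hset swap_vset c)+
    show "(prod.swap \<circ> f \<circ> prod.swap) ` hset U \<subseteq> vset G" "(prod.swap \<circ> g \<circ> prod.swap) ` vset G \<subseteq> hset U"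
      by (simp_all only: image_comp[symmetric] swap_hset swap_vset hom_img order_refl)
    show "(prod.swap \<circ> g \<circ> prod.swap) ((prod.swap \<circ> f \<circ> prod.swap) z) = z" if "z \<in> hset U" for z
    proof -
      have "prod.swap z \<in> vset U" using that by (auto simp: hset_def vset_def)
      thus ?thesis using hom by (simp add: homeomorphism_def)
    qed
    show "(prod.swap \<circ> f \<circ> prod.swap) ((prod.swap \<circ> g \<circ> prod.swap) z) = z" if "z \<in> vset G" for z
    proof -
      have "prod.swap z \<in> hset G" using that by (auto simp: hset_def vset_def)
      thus ?thesis using hom by (simp add: homeomorphism_def)
    qed
  qed
  have unswap: "prod.swap \<circ> (prod.swap \<circ> g \<circ> prod.swap) \<circ> prod.swap = g" by (simp add: fun_eq_iff)
  have height: "snd ((prod.swap \<circ> f \<circ> prod.swap) z) \<in> {lo G, hi G}"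
    if z: "z \<in> horizontal_graph (lo U) (hi U) (curve1 U) \<union> horizontal_graph (lo U) (hi U) (curve2 U)" for z
  proof -
    have z': "prod.swap z \<in> vertical_graph (lo U) (hi U) (curve1 U) \<union> vertical_graph (lo U) (hi U) (curve2 U)"
      using z by (auto simp: horizontal_graph_def vertical_graph_def)
    hence "prod.swap z \<in> vset U" using U_less by (force simp: vertical_graph_def vset_def)
    hence fG: "f (prod.swap z) \<in> hset G" using hom by (auto simp: homeomorphism_def)
    obtain x y where fz: "f (prod.swap z) = (x, y)" by fastforce
    have "x = curve1 V' y \<or> x = curve2 V' y"
      using subsetD[OF sides imageI[OF z']] fz by (auto simp: vertical_graph_def)
    hence "x = lo G \<or> x = hi G"
      using strip_meets_left[OF V' G \<alpha>\<beta> GV', of x y] strip_meets_right[OF V' G \<alpha>\<beta> GV', of x y] fG fz by auto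
    thus ?thesis using fz by auto
  qed
  obtain S where S: "lo S = lo G" "hi S = hi G" "lipschitz_strip \<beta> S"
    "vset S = (prod.swap \<circ> f \<circ> prod.swap) ` (hset U \<inter> vset H)"
    "width S \<le> \<mu> / (1 - \<beta> * \<alpha>) * width H"
  proof (rule strip_transform[OF H hset_compact[OF U] hom' _ _ \<mu> \<alpha> _ G_lohi])
    show "cone_expanding \<beta> \<mu> (prod.swap \<circ> f \<circ> prod.swap) (hset U)" using exp by (simp add: swap_vset)
    show "cone_expanding \<alpha> \<mu> (prod.swap \<circ> (prod.swap \<circ> g \<circ> prod.swap) \<circ> prod.swap) (prod.swap ` vset G)"
      unfolding unswap swap_vset by (rule exp')
    show \<beta>\<alpha>: "\<beta> * \<alpha> < 1" using \<alpha>\<beta> by (simp add: mult.commute)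
    fix h assume h: "\<beta>-lipschitz_on {lo H..hi H} h"
      and between: "\<And>x. x \<in> {lo H..hi H} \<Longrightarrow> h x \<in> {curve1 H x..curve2 H x}"
    have hV: "h x \<in> {lo U..hi U}" if "x \<in> {lo H..hi H}" for x
    proof -
      have "(x, h x) \<in> hset H" using between[OF that] that by (simp add: hset_def)
      hence "(x, h x) \<in> vset V" using HV by blast
      thus ?thesis using U_full by (auto simp: vset_def)
    qed
    define cl where "cl = (\<lambda>y. max (lo U) (min (hi U) y))"
    have cl: "cl (h x) = h x" if "x \<in> {lo H..hi H}" for x using hV[OF that] by (auto simp: cl_def)
    have U_in: "curve1 V y \<le> curve1 U y" "curve2 U y \<le> curve2 V y" if "y \<in> {lo U..hi U}" for y
    proof -
      have "(curve1 U y, y) \<in> vset U" "(curve2 U y, y) \<in> vset U"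
        using U_less[OF that] that by (auto simp: vset_def)
      hence "(curve1 U y, y) \<in> vset V" "(curve2 U y, y) \<in> vset V" using U_full by auto
      thus "curve1 V y \<le> curve1 U y" "curve2 U y \<le> curve2 V y" by (auto simp: vset_def)
    qed
    have lo_in: "lo H \<in> {lo H..hi H}" "hi H \<in> {lo H..hi H}" using H_lohi by auto
    show "\<exists>p q. p < q \<and> {x \<in> {lo H..hi H}. (h x, x) \<in> hset U} = {p..q} \<and>
              snd ((prod.swap \<circ> f \<circ> prod.swap) (h p, p)) \<in> {lo G, hi G} \<and>
              snd ((prod.swap \<circ> f \<circ> prod.swap) (h q, q)) \<in> {lo G, hi G}"
    proof (rule curve_crosses_strip[OF U h \<beta>\<alpha> _ cl_def])
      show "lo H \<le> hi H" using H_lohi by simp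
      have "lo H = curve1 V (h (lo H))"
        using strip_sides_left[OF V H \<alpha>\<beta> HV between[OF lo_in(1)]] by simp
      thus "lo H \<le> curve1 U (cl (h (lo H)))"
        using U_in(1)[OF hV[OF lo_in(1)]] cl[OF lo_in(1)] by simp
      have "hi H = curve2 V (h (hi H))"
        using strip_sides_right[OF V H \<alpha>\<beta> HV between[OF lo_in(2)]] by simp
      thus "curve2 U (cl (h (hi H))) \<le> hi H"
        using U_in(2)[OF hV[OF lo_in(2)]] cl[OF lo_in(2)] by simp
      show "h x \<in> {lo U..hi U}" if "x \<in> {lo H..hi H}" for x using hV[OF that] .
    next
      fix p q
      assume pq: "p < q" "{x \<in> {lo H..hi H}. (h x, x) \<in> hset U} = {p..q}"
        "(h p, p) \<in> horizontal_graph (lo U) (hi U) (curve1 U)"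
        "(h q, q) \<in> horizontal_graph (lo U) (hi U) (curve2 U)"
      show ?thesis
        using pq(1,2) height[OF UnI1[OF pq(3)]] height[OF UnI2[OF pq(4)]] by blast
    qed
  qed
  have "hset S = prod.swap ` vset S" by (simp add: swap_vset)
  also have "\<dots> = f ` (prod.swap ` (hset U \<inter> vset H))"
    unfolding S(4) image_comp by (simp add: comp_def)
  also have "prod.swap ` (hset U \<inter> vset H) = vset U \<inter> hset H"
    by (simp add: image_Int[OF inj_swap] swap_hset swap_vset)
  finally have "hset S = f ` (vset U \<inter> hset H)" .
  thus thesis using that[of S] S by (simp add: mult.commute)
qed

section \<open>From the nonautonomous conditions to strips and cones\<close>

lemma vertical_strip_lipschitz: "vertical_strip D \<alpha> S \<Longrightarrow> 0 \<le> \<alpha> \<Longrightarrow> lipschitz_strip \<alpha> S"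
  and horizontal_strip_lipschitz: "horizontal_strip D \<alpha> S \<Longrightarrow> 0 \<le> \<alpha> \<Longrightarrow> lipschitz_strip \<alpha> S"
  by (auto simp: vertical_strip_def vertical_curve_def horizontal_strip_def horizontal_curve_def
      lipschitz_strip_def lipschitz_on_def dist_real_def)

lemma graphs_subset_strip:
  assumes "lipschitz_strip \<alpha> S"
  shows "vertical_graph (lo S) (hi S) (curve1 S) \<subseteq> vset S" "vertical_graph (lo S) (hi S) (curve2 S) \<subseteq> vset S"
    "horizontal_graph (lo S) (hi S) (curve1 S) \<subseteq> hset S" "horizontal_graph (lo S) (hi S) (curve2 S) \<subseteq> hset S"
  using assms
  by (auto simp: vertical_graph_def horizontal_graph_def vset_def hset_def lipschitz_strip_def intro: less_imp_le)

lemma vertical_stripI: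
  assumes S: "lipschitz_strip \<alpha> S" and D: "vset S \<subseteq> D"
  shows "vertical_strip D \<alpha> S"
  using S graphs_subset_strip[OF S] D
  by (simp add: vertical_strip_def vertical_curve_def lipschitz_strip_def lipschitz_on_def dist_real_def)
     (meson order_trans)

lemma horizontal_stripI:
  assumes S: "lipschitz_strip \<alpha> S" and D: "hset S \<subseteq> D"
  shows "horizontal_strip D \<alpha> S"
  using S graphs_subset_strip[OF S] D
  by (simp add: horizontal_strip_def horizontal_curve_def lipschitz_strip_def lipschitz_on_def dist_real_def)
     (meson order_trans)

text \<open>
  Strips have nonempty ends at two different heights, so both ends of \<open>W\<close> can only be contained in
  the ends of \<open>V\<close> if the height intervals agree.
\<close>

lemma intersects_fully_iff:
  assumes W: "lipschitz_strip \<alpha> W" and V: "lipschitz_strip \<beta> V"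
  shows "intersects_fully W V \<longleftrightarrow> vset W \<subseteq> vset V \<and> lo W = lo V \<and> hi W = hi V"
proof -
  have lohi: "lo W < hi W" "lo V < hi V" using W V by (auto simp: lipschitz_strip_def)
  note fr = frontier_real_interval[OF lohi(1)] frontier_real_interval[OF lohi(2)]
  show ?thesis
  proof
    assume full: "intersects_fully W V"
    have less: "curve1 W (lo W) < curve2 W (lo W)" "curve1 W (hi W) < curve2 W (hi W)"
      using W by (auto simp: lipschitz_strip_def)
    have "(curve1 W (lo W), lo W) \<in> vstrip_hbd W" "(curve1 W (hi W), hi W) \<in> vstrip_hbd W"
      unfolding vstrip_hbd_def fr using lohi less by (auto simp: vset_def)
    hence "(curve1 W (lo W), lo W) \<in> vstrip_hbd V" "(curve1 W (hi W), hi W) \<in> vstrip_hbd V"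
      using full unfolding intersects_fully_def by blast+
    hence "lo W \<in> {lo V, hi V}" "hi W \<in> {lo V, hi V}"
      unfolding vstrip_hbd_def fr by auto
    thus "vset W \<subseteq> vset V \<and> lo W = lo V \<and> hi W = hi V"
      using lohi full by (auto simp: intersects_fully_def)
  next
    assume "vset W \<subseteq> vset V \<and> lo W = lo V \<and> hi W = hi V"
    thus "intersects_fully W V" by (auto simp: intersects_fully_def vstrip_hbd_def)
  qed
qed

lemma swap_has_derivative:
  fixes f :: "plane \<Rightarrow> plane"
  assumes "(f has_derivative f') (at (prod.swap z) within K)"
  shows "(prod.swap \<circ> f \<circ> prod.swap has_derivative prod.swap \<circ> f' \<circ> prod.swap) (at z within prod.swap ` K)"
proof -
  have swap: "(prod.swap has_derivative prod.swap) F" for F :: "plane filter"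
    unfolding prod.swap_def
    by (intro bounded_linear_imp_has_derivative bounded_linear_Pair bounded_linear_fst bounded_linear_snd)
  have "(f \<circ> prod.swap has_derivative f' \<circ> prod.swap) (at z within prod.swap ` K)"
    by (rule diff_chain_within[OF swap]) (use assms in \<open>simp add: image_comp\<close>)
  from diff_chain_within[OF this swap] show ?thesis by (simp add: comp_assoc)
qed

lemma A3_stable_cone_expanding:
  assumes A3: "A3 f Df Dfinv V N \<mu>h \<mu>v \<mu>"
    and C1: "C1_on (f n ` vstrips V N n) (finv f V N n) (Dfinv n)"
  shows "cone_expanding \<mu>v \<mu> (finv f V N n) (calH f V N (n + 1))"
proof -
  have sub: "calH f V N (n + 1) \<subseteq> f n ` vstrips V N n"
    by (auto simp: calH_def Hij_def vstrips_def)
  have \<mu>: "0 < \<mu>" using A3 by (simp add: A3_def)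
  show ?thesis
    unfolding cone_expanding_def
  proof (intro exI[of _ "\<lambda>z. blinfun_apply (Dfinv n z)"] conjI ballI allI impI)
    fix z assume "z \<in> calH f V N (n + 1)"
    thus "(finv f V N n has_derivative blinfun_apply (Dfinv n z)) (at z within calH f V N (n + 1))"
      using C1 sub unfolding C1_on_def by (meson has_derivative_subset subsetD)
  next
    have "continuous_on (calH f V N (n + 1)) (Dfinv n)"
      using C1 sub unfolding C1_on_def by (meson continuous_on_subset)
    thus "continuous_on (calH f V N (n + 1)) (\<lambda>z. snd (blinfun_apply (Dfinv n z) (0, 1)))"
      by (intro continuous_intros)
  next
    fix z \<xi> \<eta> assume z: "z \<in> calH f V N (n + 1)" and \<xi>: "\<bar>\<xi>\<bar> \<le> \<mu>v * \<bar>\<eta>\<bar>"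
    let ?w = "blinfun_apply (Dfinv n z) (\<xi>, \<eta>)"
    have s: "(z, \<xi>, \<eta>) \<in> stable_sector \<mu>v (calH f V N (n + 1))"
      using z \<xi> by (simp add: stable_sector_def)
    have t: "tangent_map (finv f V N n) (Dfinv n) (z, \<xi>, \<eta>) \<in> stable_sector \<mu>v (calV f V N n)"
      using A3 s unfolding A3_def by blast
    show "\<bar>fst ?w\<bar> \<le> \<mu>v * \<bar>snd ?w\<bar>"
      using t by (cases "?w") (simp add: tangent_map_def stable_sector_def)
    have "1 / \<mu> * \<bar>snd (\<xi>, \<eta>)\<bar> \<le> \<bar>snd ?w\<bar>"
      using A3 s t unfolding A3_def by blast
    thus "\<bar>\<eta>\<bar> \<le> \<mu> * \<bar>snd ?w\<bar>" using \<mu> by (simp add: field_simps)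
  qed
qed

lemma A3_unstable_cone_expanding:
  assumes A3: "A3 f Df Dfinv V N \<mu>h \<mu>v \<mu>"
    and C1: "C1_on (D n) (f n) (Df n)" and sub: "calV f V N n \<subseteq> D n"
  shows "cone_expanding \<mu>h \<mu> (prod.swap \<circ> f n \<circ> prod.swap) (prod.swap ` calV f V N n)"
proof -
  have \<mu>: "0 < \<mu>" using A3 by (simp add: A3_def)
  let ?L = "\<lambda>z. prod.swap \<circ> blinfun_apply (Df n (prod.swap z)) \<circ> prod.swap"
  show ?thesis
    unfolding cone_expanding_def
  proof (intro exI[of _ ?L] conjI ballI allI impI)
    fix z assume z: "z \<in> prod.swap ` calV f V N n"
    hence "prod.swap z \<in> calV f V N n" by auto
    hence "(f n has_derivative blinfun_apply (Df n (prod.swap z))) (at (prod.swap z) within calV f V N n)"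
      using C1 sub unfolding C1_on_def by (meson has_derivative_subset subsetD)
    thus "(prod.swap \<circ> f n \<circ> prod.swap has_derivative ?L z) (at z within prod.swap ` calV f V N n)"
      by (rule swap_has_derivative)
  next
    have "continuous_on (D n) (Df n)" using C1 by (simp add: C1_on_def)
    hence "continuous_on (prod.swap ` calV f V N n) (\<lambda>z. Df n (prod.swap z))"
      by (rule continuous_on_compose2) (use sub in \<open>auto intro: continuous_on_swap\<close>)
    hence "continuous_on (prod.swap ` calV f V N n) (\<lambda>z. fst (blinfun_apply (Df n (prod.swap z)) (1, 0)))"
      by (intro continuous_intros)
    thus "continuous_on (prod.swap ` calV f V N n) (\<lambda>z. snd (?L z (0, 1)))" by simp
  next
    fix z \<eta> \<xi> assume z: "z \<in> prod.swap ` calV f V N n" and \<eta>: "\<bar>\<eta>\<bar> \<le> \<mu>h * \<bar>\<xi>\<bar>"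
    let ?w = "blinfun_apply (Df n (prod.swap z)) (\<xi>, \<eta>)"
    have s: "(prod.swap z, \<xi>, \<eta>) \<in> unstable_sector \<mu>h (calV f V N n)"
      using z \<eta> by (auto simp: unstable_sector_def)
    have t: "tangent_map (f n) (Df n) (prod.swap z, \<xi>, \<eta>) \<in> unstable_sector \<mu>h (calH f V N (n + 1))"
      using A3 s unfolding A3_def by blast
    show "\<bar>fst (?L z (\<eta>, \<xi>))\<bar> \<le> \<mu>h * \<bar>snd (?L z (\<eta>, \<xi>))\<bar>"
      using t by (cases "?w") (simp add: tangent_map_def unstable_sector_def)
    have "1 / \<mu> * \<bar>fst (\<xi>, \<eta>)\<bar> \<le> \<bar>fst ?w\<bar>"
      using A3 s t unfolding A3_def by blast
    thus "\<bar>\<xi>\<bar> \<le> \<mu> * \<bar>snd (?L z (\<eta>, \<xi>))\<bar>" using \<mu> by (simp add: field_simps)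
  qed
qed

section \<open>Conditions A1 and A3 imply A2\<close>

theorem theorem4:
  fixes f :: "int \<Rightarrow> plane \<Rightarrow> plane"
    and D :: "int \<Rightarrow> plane set"
    and V :: "int \<Rightarrow> nat \<Rightarrow> strip"
    and N :: nat
    and \<mu>h \<mu>v \<mu> :: real
    and Df Dfinv :: "int \<Rightarrow> plane \<Rightarrow> plane \<Rightarrow>\<^sub>L plane"
  assumes "setting f D V N \<mu>h \<mu>v"
    and "\<And>n. C1_on (D n) (f n) (Df n)"
    and "\<And>n. C1_on (f n ` vstrips V N n) (finv f V N n) (Dfinv n)"
    and "A1 f D V N \<mu>h \<mu>v"
    and "A3 f Df Dfinv V N \<mu>h \<mu>v \<mu>"
    and "0 < \<mu>" and "\<mu> < 1 - \<mu>h * \<mu>v"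
  shows "A2 f D V N \<mu>h \<mu>v"
proof -
  define \<nu> where "\<nu> = \<mu> / (1 - \<mu>v * \<mu>h)"
  have \<mu>h: "0 \<le> \<mu>h" and \<mu>v: "0 \<le> \<mu>v" using assms(1) by (auto simp: setting_def)
  have \<mu>vh: "\<mu>v * \<mu>h < 1" using assms(4) by (simp add: A1_def)
  have \<nu>: "0 < \<nu>" "\<nu> < 1"
    using assms(6,7) \<mu>vh by (simp_all add: \<nu>_def mult.commute)
  have V_strip: "lipschitz_strip \<mu>v (V n i)" and V_sub: "vset (V n i) \<subseteq> D n" if "i \<in> {1..N}" for n i
    using assms(1) that vertical_strip_lipschitz[OF _ \<mu>v] unfolding setting_def by blast+
  have finv_f: "finv f V N n (f n z) = z" if "z \<in> vset (V n i)" "i \<in> {1..N}" for n i z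
  proof -
    have "inj_on (f n) (vstrips V N n)" using assms(1) by (simp add: setting_def)
    moreover have "z \<in> vstrips V N n" using that by (auto simp: vstrips_def)
    ultimately show ?thesis unfolding finv_def by (rule inv_into_f_f)
  qed
  have stable: "cone_expanding \<mu>v \<mu> (finv f V N n) (Hij f V (n + 1) i j)"
    and unstable: "cone_expanding \<mu>h \<mu> (prod.swap \<circ> f n \<circ> prod.swap) (prod.swap ` Vji f V n j i)"
    if "i \<in> {1..N}" "j \<in> {1..N}" for n i j
  proof -
    have "Hij f V (n + 1) i j \<subseteq> calH f V N (n + 1)" using that by (force simp: calH_def)
    with A3_stable_cone_expanding[OF assms(5,3)]
    show "cone_expanding \<mu>v \<mu> (finv f V N n) (Hij f V (n + 1) i j)" by (rule cone_expanding_subset)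
    have "calV f V N n \<subseteq> D n" using V_sub by (force simp: calV_def Vji_def)
    moreover have "prod.swap ` Vji f V n j i \<subseteq> prod.swap ` calV f V N n"
      by (rule image_mono) (use that in \<open>force simp: calV_def\<close>)
    ultimately show "cone_expanding \<mu>h \<mu> (prod.swap \<circ> f n \<circ> prod.swap) (prod.swap ` Vji f V n j i)"
      using A3_unstable_cone_expanding[where D = D and n = n, OF assms(5) assms(2)] cone_expanding_subset
      by blast
  qed
  \<comment> \<open>The strip provided by A1 for an admissible transition, in the form used below.\<close>
  have Markov: "\<exists>G. lipschitz_strip \<mu>h G \<and> hset G = Hij f V (n + 1) i j \<and>
      hset G \<subseteq> vset (V (n + 1) j) \<and> hstrip_vbd G \<subseteq> vstrip_vbd (V (n + 1) j) \<and>
      homeomorphism (Vji f V n j i) (hset G) (f n) (finv f V N n) \<and>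
      finv f V N n ` hstrip_hbd G \<subseteq> vstrip_hbd (V n i)"
    if ij: "i \<in> {1..N}" "j \<in> {1..N}" "transition f V n i j = 1" for n i j
  proof -
    obtain G where G: "hset G = Hij f V (n + 1) i j" "horizontal_strip (D (n + 1)) \<mu>h G"
      "hstrip_contained_in G (V (n + 1) j)"
      "homeomorphism (Vji f V n j i) (Hij f V (n + 1) i j) (f n) (finv f V N n)"
      "finv f V N n ` hstrip_hbd G \<subseteq> vstrip_hbd (V n i)"
      using assms(4) ij unfolding A1_def by blast
    moreover have "hset G \<subseteq> vset (V (n + 1) j)" using G(1) by (auto simp: Hij_def)
    ultimately show ?thesis
      using horizontal_strip_lipschitz[OF _ \<mu>h] by (intro exI[of _ G]) (simp add: hstrip_contained_in_def)
  qed
  have pullback: "\<exists>S. lo S = lo (V n i) \<and> hi S = hi (V n i) \<and> lipschitz_strip \<mu>v S \<and>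
      vset S = f n -` vset W \<inter> vset (V n i) \<and>
      f n ` (vertical_graph (lo S) (hi S) (curve1 S) \<union> vertical_graph (lo S) (hi S) (curve2 S))
        \<subseteq> vertical_graph (lo W) (hi W) (curve1 W) \<union> vertical_graph (lo W) (hi W) (curve2 W) \<and>
      width S \<le> \<nu> * width W"
    if ij: "i \<in> {1..N}" "j \<in> {1..N}" "transition f V n i j = 1"
      and W: "lipschitz_strip \<mu>v W" "lo W = lo (V (n + 1) j)" "hi W = hi (V (n + 1) j)"
        "vset W \<subseteq> vset (V (n + 1) j)" for n i j W
  proof -
    from Markov[OF ij] obtain G where G: "lipschitz_strip \<mu>h G" "hset G = Hij f V (n + 1) i j"
      "hset G \<subseteq> vset (V (n + 1) j)" "hstrip_vbd G \<subseteq> vstrip_vbd (V (n + 1) j)"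
      "homeomorphism (Vji f V n j i) (hset G) (f n) (finv f V N n)"
      "finv f V N n ` hstrip_hbd G \<subseteq> vstrip_hbd (V n i)" by blast
    have hom: "homeomorphism (hset G) (Vji f V n j i) (finv f V N n) (f n)"
      by (subst homeomorphism_sym) (rule G(5))
    obtain S where S: "lo S = lo (V n i)" "hi S = hi (V n i)" "lipschitz_strip \<mu>v S"
      "vset S = finv f V N n ` (hset G \<inter> vset W)"
      "vertical_graph (lo S) (hi S) (curve1 S) \<union> vertical_graph (lo S) (hi S) (curve2 S)
       = finv f V N n ` (hset G \<inter> (vertical_graph (lo W) (hi W) (curve1 W) \<union> vertical_graph (lo W) (hi W) (curve2 W)))"
      "width S \<le> \<mu> / (1 - \<mu>v * \<mu>h) * width W"
      by (rule strip_pullback[OF V_strip[OF ij(2)] V_strip[OF ij(1)] G(1) \<mu>vh assms(6) G(3,4) hom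
          stable[where n = n, OF ij(1,2), folded G(2)] unstable[OF ij(1,2)] G(6) W])
    have "vset S = f n -` vset W \<inter> vset (V n i)"
    proof (intro equalityI subsetI)
      fix z assume "z \<in> vset S"
      then obtain y where y: "y \<in> f n ` vset (V n i)" "y \<in> vset W" "z = finv f V N n y"
        unfolding S(4) G(2) Hij_def by auto
      then obtain x where x: "x \<in> vset (V n i)" "y = f n x" by blast
      have "z = x" unfolding y(3) x(2) by (rule finv_f[OF x(1) ij(1)])
      thus "z \<in> f n -` vset W \<inter> vset (V n i)" using x y(2) by simp
    next
      fix z assume z: "z \<in> f n -` vset W \<inter> vset (V n i)"
      hence "f n z \<in> hset G \<inter> vset W" using W(4) by (auto simp: G(2) Hij_def)
      hence "finv f V N n (f n z) \<in> vset S" unfolding S(4) by (rule imageI)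
      moreover have "finv f V N n (f n z) = z" by (rule finv_f[OF _ ij(1)]) (use z in simp)
      ultimately show "z \<in> vset S" by simp
    qed
    moreover have "f n ` finv f V N n ` (hset G \<inter> X) \<subseteq> X" for X
      by (auto simp: homeomorphism_apply2[OF G(5)])
    from this[of "vertical_graph (lo W) (hi W) (curve1 W) \<union> vertical_graph (lo W) (hi W) (curve2 W)"]
    have "f n ` (vertical_graph (lo S) (hi S) (curve1 S) \<union> vertical_graph (lo S) (hi S) (curve2 S))
        \<subseteq> vertical_graph (lo W) (hi W) (curve1 W) \<union> vertical_graph (lo W) (hi W) (curve2 W)"
      unfolding S(5) .
    ultimately show ?thesis using S(1-3) S(6)[folded \<nu>_def] by blast
  qed
  have pushforward: "\<exists>S. horizontal_strip (D (n + 1)) \<mu>h S \<and> hstrip_contained_in S (V (n + 1) k) \<and>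
      hset S = f n ` hset H \<inter> vset (V (n + 1) k) \<and> width S \<le> \<nu> * width H"
    if jk: "j \<in> {1..N}" "k \<in> {1..N}" "transition f V n j k = 1"
      and H: "lipschitz_strip \<mu>h H" "hset H \<subseteq> vset (V n j)" "hstrip_vbd H \<subseteq> vstrip_vbd (V n j)" for n j k H
  proof -
    from Markov[OF jk] obtain G where G: "lipschitz_strip \<mu>h G" "hset G = Hij f V (n + 1) j k"
      "hset G \<subseteq> vset (V (n + 1) k)" "hstrip_vbd G \<subseteq> vstrip_vbd (V (n + 1) k)"
      "homeomorphism (Vji f V n k j) (hset G) (f n) (finv f V N n)" by blast
    from pullback[OF jk V_strip[OF jk(2)] refl refl order_refl] obtain U where
      U: "lo U = lo (V n j)" "hi U = hi (V n j)" "lipschitz_strip \<mu>v U"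
        "vset U = f n -` vset (V (n + 1) k) \<inter> vset (V n j)"
        "f n ` (vertical_graph (lo U) (hi U) (curve1 U) \<union> vertical_graph (lo U) (hi U) (curve2 U))
          \<subseteq> vertical_graph (lo (V (n + 1) k)) (hi (V (n + 1) k)) (curve1 (V (n + 1) k))
            \<union> vertical_graph (lo (V (n + 1) k)) (hi (V (n + 1) k)) (curve2 (V (n + 1) k))" by blast
    \<comment> \<open>The preimage of the full strip V (n + 1) k is exactly the domain of the branch of f n that
      leads from V n j to it, and its boundary curves go to those of V (n + 1) k.\<close>
    have UV: "vset U \<subseteq> vset (V n j)" using U(4) by simp
    have U_eq: "vset U = Vji f V n k j" using U(4) by (simp add: Vji_def)
    obtain S where S: "lo S = lo G" "hi S = hi G" "lipschitz_strip \<mu>h S"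
      "hset S = f n ` (vset U \<inter> hset H)" "width S \<le> \<mu> / (1 - \<mu>v * \<mu>h) * width H"
      by (rule strip_pushforward[OF V_strip[OF jk(1)] U(3) V_strip[OF jk(2)] G(1) H(1) \<mu>vh assms(6)
          U(1,2) UV H(2,3) G(3,4) G(5)[folded U_eq] unstable[where n = n, OF jk(1,2), folded U_eq]
          stable[where n = n, OF jk(1,2), folded G(2)] U(5)])
    have S_eq: "hset S = f n ` hset H \<inter> vset (V (n + 1) k)"
      unfolding S(4) U(4) using H(2) by auto
    have "hset S \<subseteq> D (n + 1)" using S_eq V_sub[OF jk(2)] by blast
    moreover have "hset S \<subseteq> hset G"
      unfolding S_eq G(2) Hij_def using H(2) by auto
    hence "hstrip_vbd S \<subseteq> hstrip_vbd G" using S(1,2) by (auto simp: hstrip_vbd_def)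
    hence "hstrip_contained_in S (V (n + 1) k)"
      using graphs_subset_strip(3,4)[OF S(3)] S_eq G(4) unfolding hstrip_contained_in_def by blast
    ultimately show ?thesis
      using horizontal_stripI[OF S(3)] S_eq S(5) by (intro exI[of _ S]) (simp add: \<nu>_def)
  qed
  show ?thesis
    unfolding A2_def
  proof (intro conjI exI[of _ \<nu>] \<nu> allI ballI impI)
    fix n j W i
    assume j: "j \<in> {1..N}" and i: "i \<in> {1..N}" and A: "transition f V n i j = 1"
      and W: "vertical_strip (D (n + 1)) \<mu>v W \<and> intersects_fully W (V (n + 1) j)"
    have W_lip: "lipschitz_strip \<mu>v W" using vertical_strip_lipschitz[OF _ \<mu>v] W by blast
    hence "vset W \<subseteq> vset (V (n + 1) j)" "lo W = lo (V (n + 1) j)" "hi W = hi (V (n + 1) j)"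
      using W intersects_fully_iff[OF W_lip V_strip[OF j]] by auto
    from pullback[OF i j A W_lip this(2,3,1)] obtain S where
      S: "lo S = lo (V n i)" "hi S = hi (V n i)" "lipschitz_strip \<mu>v S"
        "vset S = f n -` vset W \<inter> vset (V n i)" "width S \<le> \<nu> * width W" by blast
    have SV: "vset S \<subseteq> vset (V n i)" using S(4) by simp
    show "\<exists>W'. vset W' = f n -` vset W \<inter> vset (V n i) \<and> vertical_strip (D n) \<mu>v W' \<and>
        intersects_fully W' (V n i) \<and> width W' \<le> \<nu> * width W"
      using S SV vertical_stripI[OF S(3) order_trans[OF SV V_sub[OF i]]]
        intersects_fully_iff[OF S(3) V_strip[OF i]] by blast
  next
    fix n i j H k
    assume j: "j \<in> {1..N}" and k: "k \<in> {1..N}" and A: "transition f V n j k = 1"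
      and H: "transition f V (n - 1) i j = 1 \<and> horizontal_strip (D n) \<mu>h H \<and>
        hstrip_contained_in H (V n j) \<and> hset H \<subseteq> Hij f V n i j"
    have "lipschitz_strip \<mu>h H" using horizontal_strip_lipschitz[OF _ \<mu>h] H by blast
    moreover have "hset H \<subseteq> vset (V n j)" using H by (auto simp: Hij_def)
    moreover have "hstrip_vbd H \<subseteq> vstrip_vbd (V n j)" using H by (simp add: hstrip_contained_in_def)
    ultimately show "\<exists>H'. hset H' = f n ` hset H \<inter> vset (V (n + 1) k) \<and>
        horizontal_strip (D (n + 1)) \<mu>h H' \<and> hstrip_contained_in H' (V (n + 1) k) \<and>
        width H' \<le> \<nu> * width H"
      using pushforward[OF j k A] by blast
  qed
qed

end
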